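(* Let $T$ be a tree on $n$ vertices with $\kappa_{\mathrm m}(T)=2$, write $M_T(x)=f(x)g(x)$ with $f,g$ distinct, monic and irreducible over $\mathbb Q$, and let $\Gamma_T=\Gamma_f+\Gamma_g$ be the canonical factor-coronal decomposition. Suppose that, after interchanging $f$ and $g$ if necessary, there exist a tree $R$ and a connected bipartite unicyclic graph $U$ such that $\Gamma_R=\Gamma_f$ and $\Gamma_U=\Gamma_g$. Set $H:=R\cup U$ (disjoint union). Let $C=C_{2\ell}$ be the unique cycle of $U$, and put $F:=U-V(C)$. Define $$d:=\deg\frac{\phi_T}{M_T}=n-\deg M_T.$$ Let $s$ be an integer with $0\le s\le\lfloor n/2\rfloor$. Suppose that $$m_k(T)=m_k(H)-2(-1)^\ell\, m_{k-\ell}(R\cup F),\qquad 0\le k\le s,$$ where $m_j(X)=0$ for $j<0$. If $d\le 2s+1$, then $T$ and $H$ are generalized cospectral. In particular, the conclusion that $T$ and $H$ are generalized cospectral holds automatically (that is, without assuming the displayed matching identities) if $d\le3$. It also holds automatically if the unique cycle of $U$ has length at least six and $d\le5$.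
   Context: All graphs are finite, simple and undirected. For a graph $X$, $A(X)$ is its adjacency matrix, $\phi_X(x)=\det(xI-A(X))$, $\mathbf 1$ is the all-one vector, the coronal is $\Gamma_X(x)=\mathbf 1^{T}(xI-A(X))^{-1}\mathbf 1$, and $m_k(X)$ is the number of $k$-matchings of $X$ (with $m_0(X)=1$). Two graphs are generalized cospectral if they have the same adjacency spectrum and their complements have the same adjacency spectrum. An adjacency eigenvalue is main if its eigenspace is not orthogonal to $\mathbf 1$; the main polynomial $M_X(x)$ is the product of $(x-\lambda)$ over the distinct main eigenvalues $\lambda$ of $X$; it divides $\phi_X$ in $\mathbb Z[x]$ and is the monic reduced denominator of $\Gamma_X$. If $\phi_X=\prod_{i=1}^r f_i^{m_i}$ with $f_i$ distinct, monic and irreducible over $\mathbb Q$, the main-factor multiplicity is $\kappa_{\mathrm m}(X):=\sum_{i:\,f_i\mid M_X} m_i$. When $T$ is a tree with $\kappa_{\mathrm m}(T)=2$, $M_T=fg$ with $f,g$ distinct monic irreducible, and the canonical factor-coronal decomposition is the unique proper partial-fraction decomposition $\Gamma_T=\Gamma_f+\Gamma_g$ with $\Gamma_f=A/f$, $\Gamma_g=B/g$, $A,B\in\mathbb Q[x]$, $\deg A<\deg f$, $\deg B<\deg g$. A connected graph is unicyclic if it contains exactly one cycle. $U-V(C)$ is $U$ with all vertices of $C$ deleted. *)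

theory Defs
  imports
    "HOL-Computational_Algebra.Computational_Algebra"
    "HOL-Computational_Algebra.Field_as_Ring"
    "HOL-Library.Disjoint_Sets"
    "Jordan_Normal_Form.Char_Poly"
    "Jordan_Normal_Form.Gauss_Jordan_Elimination"
begin

section \<open>Finite simple graphs\<close>

record 'a sgraph =
  verts :: "'a set"
  edges :: "'a set set"

definition simple_graph :: "'a sgraph \<Rightarrow> bool" where
  "simple_graph G \<longleftrightarrow> finite (verts G) \<and>
     edges G \<subseteq> {{u, v} | u v. u \<in> verts G \<and> v \<in> verts G \<and> u \<noteq> v}"

definition num_verts :: "'a sgraph \<Rightarrow> nat" where
  "num_verts G = card (verts G)"

definition complement :: "'a sgraph \<Rightarrow> 'a sgraph" where
  "complement G = \<lparr> verts = verts G,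
     edges = {{u, v} | u v. u \<in> verts G \<and> v \<in> verts G \<and> u \<noteq> v} - edges G \<rparr>"

definition disjoint_union :: "'a sgraph \<Rightarrow> 'b sgraph \<Rightarrow> ('a + 'b) sgraph" where
  "disjoint_union G H = \<lparr> verts = Inl ` verts G \<union> Inr ` verts H,
     edges = (\<lambda>e. Inl ` e) ` edges G \<union> (\<lambda>e. Inr ` e) ` edges H \<rparr>"

definition delete_verts :: "'a sgraph \<Rightarrow> 'a set \<Rightarrow> 'a sgraph" where
  "delete_verts G S = \<lparr> verts = verts G - S, edges = {e \<in> edges G. e \<inter> S = {}} \<rparr>"

definition subgraph :: "'a sgraph \<Rightarrow> 'a sgraph \<Rightarrow> bool" where
  "subgraph G H \<longleftrightarrow> verts G \<subseteq> verts H \<and> edges G \<subseteq> edges H"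

definition connected_graph :: "'a sgraph \<Rightarrow> bool" where
  "connected_graph G \<longleftrightarrow> verts G \<noteq> {} \<and>
     (\<forall>u \<in> verts G. \<forall>v \<in> verts G. (u, v) \<in> {(x, y). {x, y} \<in> edges G}\<^sup>*)"

definition bipartite :: "'a sgraph \<Rightarrow> bool" where
  "bipartite G \<longleftrightarrow> (\<exists>X Y. verts G = X \<union> Y \<and> X \<inter> Y = {} \<and>
     (\<forall>e \<in> edges G. \<exists>x \<in> X. \<exists>y \<in> Y. e = {x, y}))"

definition cycle_graph :: "'a sgraph \<Rightarrow> bool" where
  "cycle_graph C \<longleftrightarrow> (\<exists>vs. distinct vs \<and> 3 \<le> length vs \<and> verts C = set vs \<and>
     edges C = {{vs ! i, vs ! (Suc i mod length vs)} | i. i < length vs})"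

text \<open>A cycle of a graph is a subgraph, not a closed walk, so that rotations and reversals of
  a closed walk do not count as different cycles.\<close>

definition cycle_of :: "'a sgraph \<Rightarrow> 'a sgraph \<Rightarrow> bool" where
  "cycle_of C G \<longleftrightarrow> cycle_graph C \<and> subgraph C G"

definition tree :: "'a sgraph \<Rightarrow> bool" where
  "tree G \<longleftrightarrow> simple_graph G \<and> connected_graph G \<and> (\<nexists>C. cycle_of C G)"

definition unicyclic :: "'a sgraph \<Rightarrow> bool" where
  "unicyclic G \<longleftrightarrow> simple_graph G \<and> connected_graph G \<and> (\<exists>!C. cycle_of C G)"

text \<open>The index is an integer, so that the number of \<open>j\<close>-matchings is 0 for \<open>j < 0\<close>.\<close>

definition num_matchings :: "'a sgraph \<Rightarrow> int \<Rightarrow> nat" where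
  "num_matchings G j = card {M. M \<subseteq> edges G \<and> disjoint M \<and> int (card M) = j}"


section \<open>Adjacency matrices and spectra\<close>

text \<open>The rows and columns of the adjacency matrix are indexed by \<open>{0..<num_verts G}\<close> through an
  arbitrary enumeration of the vertices. Another enumeration conjugates the matrix by a
  permutation matrix, which changes none of the notions defined from it below.\<close>

definition vertex_enum :: "'a sgraph \<Rightarrow> 'a list" where
  "vertex_enum G = (SOME vs. distinct vs \<and> set vs = verts G)"

definition adj_matrix :: "'a sgraph \<Rightarrow> 'b :: {zero, one} mat" where
  "adj_matrix G = mat (num_verts G) (num_verts G)
     (\<lambda>(i, j). if {vertex_enum G ! i, vertex_enum G ! j} \<in> edges G then 1 else 0)"

definition graph_poly :: "'a sgraph \<Rightarrow> 'b :: comm_ring_1 poly" where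
  "graph_poly G = char_poly (adj_matrix G)"

text \<open>Taken over the complex numbers, the multiset of roots of the characteristic polynomial
  consists of all eigenvalues with their multiplicities.\<close>

definition adj_spectrum :: "'a sgraph \<Rightarrow> complex multiset" where
  "adj_spectrum G = proots (graph_poly G)"

definition generalized_cospectral :: "'a sgraph \<Rightarrow> 'b sgraph \<Rightarrow> bool" where
  "generalized_cospectral G H \<longleftrightarrow> adj_spectrum G = adj_spectrum H \<and>
     adj_spectrum (complement G) = adj_spectrum (complement H)"

definition ones_vec :: "nat \<Rightarrow> 'b :: one vec" where
  "ones_vec n = vec n (\<lambda>_. 1)"

text \<open>The coronal is an element of the field \<open>\<rat>(x)\<close>. The matrix \<open>xI - A\<close> is invertible over
  this field since its determinant is monic, so \<open>mat_inverse\<close> does not return \<open>None\<close>.\<close>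

definition coronal :: "'a sgraph \<Rightarrow> rat poly fract" where
  "coronal G =
     (let M = map_mat to_fract (char_poly_matrix (adj_matrix G))
      in ones_vec (num_verts G) \<bullet> (the (mat_inverse M) *\<^sub>v ones_vec (num_verts G)))"

text \<open>The adjacency matrix is real symmetric, so all its eigenvalues are real.\<close>

definition main_eigenvalue :: "'a sgraph \<Rightarrow> real \<Rightarrow> bool" where
  "main_eigenvalue G k \<longleftrightarrow>
     (\<exists>v. eigenvector (adj_matrix G) v k \<and> ones_vec (num_verts G) \<bullet> v \<noteq> 0)"

definition main_poly :: "'a sgraph \<Rightarrow> real poly" where
  "main_poly G = (\<Prod>k \<in> {k. main_eigenvalue G k}. [:- k, 1:])"

definition real_of_rat_poly :: "rat poly \<Rightarrow> real poly" where
  "real_of_rat_poly = map_poly of_rat"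

definition main_factor_mult :: "'a sgraph \<Rightarrow> nat" where
  "main_factor_mult G =
     (\<Sum>p \<in> {p :: rat poly. lead_coeff p = 1 \<and> irreducible p \<and> p dvd graph_poly G \<and>
            real_of_rat_poly p dvd main_poly G}.
        multiplicity p (graph_poly G))"

text \<open>\<open>factor_coronals G f g c\<^sub>f c\<^sub>g\<close>: \<open>c\<^sub>f + c\<^sub>g\<close> is the proper partial fraction decomposition of
  the coronal of \<open>G\<close> with denominators \<open>f\<close> and \<open>g\<close>; for coprime \<open>f\<close> and \<open>g\<close> this determines
  \<open>c\<^sub>f\<close> and \<open>c\<^sub>g\<close>.\<close>

definition factor_coronals ::
    "'a sgraph \<Rightarrow> rat poly \<Rightarrow> rat poly \<Rightarrow> rat poly fract \<Rightarrow> rat poly fract \<Rightarrow> bool" where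
  "factor_coronals G f g cf cg \<longleftrightarrow>
     (\<exists>A B. degree A < degree f \<and> degree B < degree g \<and>
        cf = to_fract A / to_fract f \<and> cg = to_fract B / to_fract g \<and> coronal G = cf + cg)"

end

theory Submission
  imports Defs "HOL-Combinatorics.Cycles"
begin

text \<open>The coronals of \<open>T\<close> and \<open>H\<close> coincide, since coronals are additive on disjoint unions, so by the
  rank-one formula \<open>det (M + J) = det M * (1 + \<Gamma>)\<close> it suffices to prove that \<open>T\<close> and \<open>H\<close> have the
  same characteristic polynomial. Both polynomials are divisible by \<open>f * g\<close>, the reduced denominator
  of the common coronal, which has degree \<open>n - d\<close>. Expanding the determinant over permutations, a
  permutation along the edges is an involution, that is, a matching, or it rotates a cycle of the
  graph. Hence the coefficient of \<open>x^(n - 2k)\<close> is, up to the sign \<open>(-1)^k\<close>, the number of \<open>k\<close>-matchings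
  for \<open>T\<close>, and for \<open>H\<close> this number corrected by the two rotations of the cycle \<open>C\<close>. The
  difference of the two polynomials therefore has degree less than \<open>n - d\<close> and vanishes. For small
  \<open>d\<close> the matching identities hold because the coronal determines the numbers of walks of length 0, 1
  and 2, that is, the numbers of vertices and edges and the sum of the squared degrees.\<close>

section \<open>Coronals\<close>

text \<open>What makes \<open>d \<le> 2 * s + 1\<close> the right bound is parity. Two polynomials
  divisible by \<open>f * g\<close> agree once their coefficients of x^i agree whenever n - i \<le>
  d. All coefficients with n - i odd vanish: a matching covers an even number of vertices and so
  does a rotation of the cycle of length 2l. The last odd value 2s + 1 is therefore free, and only n
  - i = 2k with k \<le> s asks for a matching identity. The constant \<open>- 2 * (- 1) ^ l\<close>
  has three sources: there are two rotations, each is an odd permutation, and the matching that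
  remains has k - l edges whereas the sign of k edges is factored out.

  Divisibility by \<open>f * g\<close> is wanted for \<open>H\<close> too, whose main polynomial is
  not given. It is read off the coronal, where the only danger is a vanishing numerator of
  \<open>\<Gamma>f\<close> or \<open>\<Gamma>g\<close>. These are coronals of nonempty graphs, whose
  leading coefficient at infinity is the number of vertices.\<close>

lemma vertex_enum:
  assumes "finite (verts G)"
  shows distinct_vertex_enum: "distinct (vertex_enum G)"
    and set_vertex_enum: "set (vertex_enum G) = verts G"
    and length_vertex_enum: "length (vertex_enum G) = num_verts G"
proof -
  have "distinct (vertex_enum G) \<and> set (vertex_enum G) = verts G"
    unfolding vertex_enum_def by (rule someI_ex) (use finite_distinct_list[OF assms] in blast)
  then show "distinct (vertex_enum G)" "set (vertex_enum G) = verts G"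
    "length (vertex_enum G) = num_verts G"
    by (auto simp: num_verts_def distinct_card[symmetric])
qed

lemma vertex_enum_index:
  assumes "finite (verts G)" "v \<in> verts G"
  shows "\<exists>i < num_verts G. v = vertex_enum G ! i"
  using assms vertex_enum by (metis in_set_conv_nth)

lemma bij_betw_vertex_enum:
  assumes "finite (verts G)"
  shows "bij_betw ((!) (vertex_enum G)) {0..<num_verts G} (verts G)"
  using vertex_enum[OF assms] by (intro bij_betw_nth) auto

definition nbs :: "'a sgraph \<Rightarrow> 'a \<Rightarrow> 'a set" where
  "nbs G v = {u \<in> verts G. {v, u} \<in> edges G}"

lemma finite_nbs: "finite (verts G) \<Longrightarrow> finite (nbs G v)"
  by (simp add: nbs_def)

lemma adj_matrix_carrier [simp]: "adj_matrix G \<in> carrier_mat (num_verts G) (num_verts G)"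
  by (simp add: adj_matrix_def)

text \<open>The entries 0 and 1 are fixed by every ring homomorphism. This moves results over
  \<open>rat\<close> to \<open>complex\<close> for the spectra and to \<open>real\<close> for the
  main polynomial.\<close>

lemma graph_poly_hom:
  assumes "comm_ring_hom h"
  shows "map_poly h (graph_poly G) = graph_poly G"
proof -
  interpret comm_ring_hom h by fact
  have "map_mat h (adj_matrix G) = adj_matrix G"
    by (rule eq_matI) (auto simp: adj_matrix_def)
  then show ?thesis
    unfolding graph_poly_def using char_poly_hom[OF adj_matrix_carrier, of G] by simp
qed

lemma degree_graph_poly: "degree (graph_poly G :: 'b :: idom poly) = num_verts G"
  and lead_coeff_graph_poly: "lead_coeff (graph_poly G :: 'b :: idom poly) = 1"
  using degree_monic_char_poly[OF adj_matrix_carrier, where ?'a = 'b]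
  unfolding graph_poly_def by metis+

lemma graph_poly_nonzero: "graph_poly G \<noteq> (0 :: 'b :: idom poly)"
  using lead_coeff_graph_poly[of G, where ?'b = 'b] by fastforce

text \<open>Vectors are written as functions on vertices, so that later arguments see neighbourhood
  sums instead of indices. The homomorphism \<open>h\<close> is general because the identity serves
  both over the polynomials, for the adjugate, and over their field of fractions, for the
  inverse.\<close>

lemma char_poly_adj_matrix_mult_vec:
  fixes h :: "rat poly \<Rightarrow> 'b :: comm_ring_1"
  assumes V: "finite (verts G)" and h: "comm_ring_hom h" and i: "i < num_verts G"
  shows "(map_mat h (char_poly_matrix (adj_matrix G)) *\<^sub>v
           vec (num_verts G) (\<lambda>i. z (vertex_enum G ! i))) $ i =
         h [:0, 1:] * z (vertex_enum G ! i) - (\<Sum>u \<in> nbs G (vertex_enum G ! i). z u)"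
proof -
  interpret comm_ring_hom h by fact
  let ?n = "num_verts G" and ?e = "(!) (vertex_enum G)"
  have "char_poly_matrix (adj_matrix G :: rat mat) \<in> carrier_mat ?n ?n" by simp
  note carrier_matD[OF this]
  then have M: "dim_row (char_poly_matrix (adj_matrix G :: rat mat)) = ?n"
    "dim_col (char_poly_matrix (adj_matrix G :: rat mat)) = ?n" by auto
  let ?a = "\<lambda>j. if {?e i, ?e j} \<in> edges G then 1 else (0 :: 'b)"
  have entry: "h (char_poly_matrix (adj_matrix G) $$ (i, j)) =
      (if i = j then h [:0, 1:] else 0) - ?a j" if "j < ?n" for j
  proof -
    have "char_poly_matrix (adj_matrix G) $$ (i, j) = (if i = j then [:0, 1:] else 0) -
        (if {?e i, ?e j} \<in> edges G then 1 else (0 :: rat poly))"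
      using i that by (simp add: char_poly_matrix_def adj_matrix_def one_pCons)
    then show ?thesis by (simp add: hom_distribs)
  qed
  have "(map_mat h (char_poly_matrix (adj_matrix G)) *\<^sub>v vec ?n (\<lambda>i. z (?e i))) $ i =
      (\<Sum>j = 0..<?n. h (char_poly_matrix (adj_matrix G) $$ (i, j)) * z (?e j))"
    using i M by (simp add: scalar_prod_def)
  also have "\<dots> = (\<Sum>j = 0..<?n. (if i = j then h [:0, 1:] * z (?e j) else 0) - ?a j * z (?e j))"
    by (intro sum.cong refl) (auto simp: entry algebra_simps)
  also have "\<dots> = h [:0, 1:] * z (?e i) - (\<Sum>j = 0..<?n. ?a j * z (?e j))"
    using i by (simp add: sum_subtractf)
  also have "(\<Sum>j = 0..<?n. ?a j * z (?e j)) =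
      (\<Sum>u\<in>verts G. (if {?e i, u} \<in> edges G then 1 else 0) * z u)"
    by (rule sum.reindex_bij_betw[OF bij_betw_vertex_enum[OF V]])
  also have "\<dots> = (\<Sum>u \<in> nbs G (?e i). z u)"
    unfolding nbs_def by (rule sum.mono_neutral_cong_right) (use V in auto)
  finally show ?thesis .
qed

lemma sum_vertex_enum:
  assumes "finite (verts G)"
  shows "(\<Sum>i = 0..<num_verts G. z (vertex_enum G ! i)) = (\<Sum>v\<in>verts G. z v)"
  by (rule sum.reindex_bij_betw[OF bij_betw_vertex_enum[OF assms]])

section \<open>Solutions of the resolvent system\<close>

lemma comm_ring_hom_to_fract: "comm_ring_hom (to_fract :: 'b :: idom \<Rightarrow> 'b fract)"
  by unfold_locales auto

abbreviation resolvent_mat :: "'a sgraph \<Rightarrow> rat poly fract mat" where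
  "resolvent_mat G \<equiv> map_mat to_fract (char_poly_matrix (adj_matrix G))"

lemma det_resolvent_mat: "det (resolvent_mat G) = to_fract (graph_poly G)"
proof -
  interpret comm_ring_hom "to_fract :: rat poly \<Rightarrow> rat poly fract"
    by (rule comm_ring_hom_to_fract)
  show ?thesis by (simp add: graph_poly_def char_poly_def)
qed

lemma resolvent_mat_carrier [simp]:
  "resolvent_mat G \<in> carrier_mat (num_verts G) (num_verts G)"
  by simp

lemma resolvent_mat_mult_solution:
  assumes V: "finite (verts G)"
    and z: "\<And>v. v \<in> verts G \<Longrightarrow> to_fract [:0, 1:] * z v - (\<Sum>u\<in>nbs G v. z u) = 1"
  shows "resolvent_mat G *\<^sub>v vec (num_verts G) (\<lambda>i. z (vertex_enum G ! i)) =
    ones_vec (num_verts G)" (is "?M *\<^sub>v ?z = ones_vec ?n")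
proof (rule eq_vecI)
  fix i assume "i < dim_vec (ones_vec ?n :: rat poly fract vec)"
  then have i: "i < ?n" by (simp add: ones_vec_def)
  then have v: "vertex_enum G ! i \<in> verts G"
    using nth_mem[of i "vertex_enum G"] by (simp only: vertex_enum[OF V])
  show "(?M *\<^sub>v ?z) $ i = ones_vec ?n $ i"
    unfolding char_poly_adj_matrix_mult_vec[OF V comm_ring_hom_to_fract i, of z] z[OF v]
    using i by (simp add: ones_vec_def)
next
  show "dim_vec (?M *\<^sub>v ?z) = dim_vec (ones_vec ?n :: rat poly fract vec)"
    by (simp add: ones_vec_def char_poly_matrix_def adj_matrix_def)
qed

text \<open>The determinant is the nonzero characteristic polynomial, so the inverse applied to the
  all-one vector is the only solution of the system. Any solution \<open>z\<close>, however it was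
  found, may thus replace \<open>mat_inverse\<close>.\<close>

lemma coronal_eq_sum:
  assumes V: "finite (verts G)"
    and z: "\<And>v. v \<in> verts G \<Longrightarrow> to_fract [:0, 1:] * z v - (\<Sum>u\<in>nbs G v. z u) = 1"
  shows "coronal G = (\<Sum>v\<in>verts G. z v)"
proof -
  let ?n = "num_verts G" and ?M = "resolvent_mat G"
  let ?z = "vec ?n (\<lambda>i. z (vertex_enum G ! i))"
  have Mz: "?M *\<^sub>v ?z = ones_vec ?n"
    by (rule resolvent_mat_mult_solution[OF V z])
  have "det ?M \<noteq> 0"
    unfolding det_resolvent_mat using graph_poly_nonzero[of G, where ?'b = rat] by simp
  then have "?M \<in> Units (ring_mat TYPE(rat poly fract) ?n ())"
    by (rule det_non_zero_imp_unit[OF resolvent_mat_carrier])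
  then have "mat_inverse ?M \<noteq> None"
    using mat_inverse(1)[OF resolvent_mat_carrier] by (rule contrapos_pn)
  then obtain B where B: "mat_inverse ?M = Some B"
    unfolding not_None_eq by (rule exE)
  have BM: "B * ?M = 1\<^sub>m ?n" "B \<in> carrier_mat ?n ?n"
    using mat_inverse(2)[OF resolvent_mat_carrier B] by (simp_all only: simp_thms)
  have "B *\<^sub>v ones_vec ?n = (B * ?M) *\<^sub>v ?z"
    unfolding Mz[symmetric]
    by (rule assoc_mult_mat_vec[OF BM(2) resolvent_mat_carrier vec_carrier, symmetric])
  also have "\<dots> = ?z"
    unfolding BM(1) by simp
  finally have "coronal G = ones_vec ?n \<bullet> ?z"
    unfolding coronal_def Let_def B option.sel by simp
  also have "\<dots> = (\<Sum>i = 0..<?n. z (vertex_enum G ! i))"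
    by (simp add: scalar_prod_def ones_vec_def)
  also have "\<dots> = (\<Sum>v\<in>verts G. z v)" by (rule sum_vertex_enum[OF V])
  finally show ?thesis .
qed

lemma smult_mat_mult_vec:
  assumes "x \<in> carrier_vec n"
  shows "(c \<cdot>\<^sub>m 1\<^sub>m n) *\<^sub>v x = c \<cdot>\<^sub>v (x :: 'b :: comm_ring_1 vec)"
  using assms by (intro eq_vecI) (auto simp: scalar_prod_smult_left)

text \<open>The witness is the adjugate of xI - A applied to the all-one vector: it clears the
  denominator \<open>graph_poly G\<close> and stays inside the polynomials.\<close>

lemma ex_coronal_numerators:
  assumes V: "finite (verts G)"
  obtains P where
    "\<And>v. v \<in> verts G \<Longrightarrow> [:0, 1:] * P v = (graph_poly G :: rat poly) + (\<Sum>u\<in>nbs G v. P u)"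
proof -
  let ?n = "num_verts G" and ?M = "char_poly_matrix (adj_matrix G) :: rat poly mat"
  let ?e = "(!) (vertex_enum G)"
  let ?y = "adj_mat ?M *\<^sub>v ones_vec ?n"
  have M: "?M \<in> carrier_mat ?n ?n" by simp
  define P where "P v = ?y $ (inv_into {0..<?n} ?e v)" for v
  have bij: "bij_betw ?e {0..<?n} (verts G)" by (rule bij_betw_vertex_enum[OF V])
  have y: "vec ?n (\<lambda>i. P (?e i)) = ?y"
    using bij adj_mat(1)[OF M] unfolding P_def
    by (intro eq_vecI) (auto simp: bij_betw_inv_into_left)
  have "?M *\<^sub>v ?y = (?M * adj_mat ?M) *\<^sub>v ones_vec ?n"
    by (rule assoc_mult_mat_vec[OF M adj_mat(1)[OF M], symmetric]) (simp add: ones_vec_def)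
  also have "\<dots> = graph_poly G \<cdot>\<^sub>v ones_vec ?n"
    unfolding adj_mat(2)[OF M] graph_poly_def char_poly_def
    by (simp add: ones_vec_def smult_mat_mult_vec)
  finally have My: "?M *\<^sub>v ?y = graph_poly G \<cdot>\<^sub>v ones_vec ?n" .
  have id: "comm_ring_hom (\<lambda>p :: rat poly. p)" by unfold_locales auto
  have map_id: "map_mat (\<lambda>p :: rat poly. p) ?M = ?M" by (rule eq_matI) auto
  have "[:0, 1:] * P v = graph_poly G + (\<Sum>u\<in>nbs G v. P u)" if v: "v \<in> verts G" for v
  proof -
    obtain i where i: "i < ?n" "v = ?e i"
      using vertex_enum_index[OF V v] by metis
    have "(?M *\<^sub>v ?y) $ i = [:0, 1:] * P v - (\<Sum>u\<in>nbs G v. P u)"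
      using char_poly_adj_matrix_mult_vec[OF V id i(1), of P] unfolding y map_id i(2) .
    moreover have "(?M *\<^sub>v ?y) $ i = graph_poly G"
      using i(1) unfolding My by (simp add: ones_vec_def)
    ultimately show ?thesis by (metis diff_add_cancel)
  qed
  then show thesis by (rule that)
qed

text \<open>The adjacency matrix is symmetric, so it may be moved from one factor of the pairing to
  the other.\<close>

lemma sum_nbs_swap:
  fixes w P :: "'a \<Rightarrow> 'b :: comm_semiring_0"
  assumes V: "finite (verts G)"
  shows "(\<Sum>v\<in>verts G. w v * (\<Sum>u\<in>nbs G v. P u)) = (\<Sum>v\<in>verts G. (\<Sum>u\<in>nbs G v. w u) * P v)"
proof -
  have nbs: "(\<Sum>u\<in>nbs G v. f u) = (\<Sum>u\<in>verts G. if {v, u} \<in> edges G then f u else 0)"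
    for f :: "'a \<Rightarrow> 'b" and v
    unfolding nbs_def using V by (intro sum.mono_neutral_cong_left) auto
  have "(\<Sum>v\<in>verts G. w v * (\<Sum>u\<in>nbs G v. P u)) =
      (\<Sum>v\<in>verts G. \<Sum>u\<in>verts G. if {v, u} \<in> edges G then w v * P u else 0)"
    unfolding nbs sum_distrib_left by (intro sum.cong refl) auto
  also have "\<dots> = (\<Sum>u\<in>verts G. \<Sum>v\<in>verts G. if {v, u} \<in> edges G then w v * P u else 0)"
    by (rule sum.swap)
  also have "\<dots> = (\<Sum>v\<in>verts G. (\<Sum>u\<in>nbs G v. w u) * P v)"
    unfolding nbs sum_distrib_right by (intro sum.cong refl) (auto simp: insert_commute)
  finally show ?thesis .
qed

text \<open>At a vertex where the degree of \<open>P\<close> takes its maximum \<open>D\<close>, the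
  left-hand side of the equation has degree \<open>D + 1\<close>, but if \<open>D\<close> were at
  least the number of vertices, the right-hand side would have degree at most
  \<open>D\<close>.\<close>

lemma degree_coronal_numerators:
  assumes V: "finite (verts G)"
    and P: "\<And>v. v \<in> verts G \<Longrightarrow> [:0, 1:] * P v = (graph_poly G :: rat poly) + (\<Sum>u\<in>nbs G v. P u)"
    and v: "v \<in> verts G"
  shows "degree (P v) < num_verts G"
proof (rule ccontr)
  assume *: "\<not> ?thesis"
  define D where "D = Max (degree ` P ` verts G)"
  have le: "degree (P u) \<le> D" if "u \<in> verts G" for u
    unfolding D_def using V that by simp
  have "D \<in> degree ` P ` verts G"
    unfolding D_def using V v by (intro Max_in) auto
  then obtain u where u: "u \<in> verts G" "degree (P u) = D" by auto
  have "num_verts G > 0"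
    using V v by (auto simp: num_verts_def card_gt_0_iff)
  with * le[OF v] have D: "D \<ge> num_verts G" "D > 0" by auto
  with u have "P u \<noteq> 0" by auto
  then have "degree ([:0, 1:] * P u) = Suc D"
    using u by simp
  moreover have "degree ((graph_poly G :: rat poly) + (\<Sum>x\<in>nbs G u. P x)) \<le> D"
    using D le by (intro degree_add_le degree_sum_le)
      (auto simp: degree_graph_poly V finite_nbs nbs_def)
  ultimately show False
    unfolding P[OF u(1)] by linarith
qed

lemma resolvent_solution:
  assumes P: "\<And>v. v \<in> verts G \<Longrightarrow> [:0, 1:] * P v = (graph_poly G :: rat poly) + (\<Sum>u\<in>nbs G v. P u)"
    and v: "v \<in> verts G"
  shows "to_fract [:0, 1:] * (to_fract (P v) / to_fract (graph_poly G)) -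
    (\<Sum>u\<in>nbs G v. to_fract (P u) / to_fract (graph_poly G)) = 1"
proof -
  let ?f = "to_fract (graph_poly G :: rat poly)" and ?x = "to_fract [:0, 1 :: rat:]"
  have "?x * to_fract (P v) = ?f + (\<Sum>u\<in>nbs G v. to_fract (P u))"
    using arg_cong[OF P[OF v], of to_fract] by (simp only: to_fract_mult to_fract_add to_fract_sum)
  then have "?x * (to_fract (P v) / ?f) - (\<Sum>u\<in>nbs G v. to_fract (P u)) / ?f = ?f / ?f"
    by (simp only: times_divide_eq_right diff_divide_distrib[symmetric] add_diff_cancel_right')
  moreover have "?f \<noteq> 0"
    by (simp add: graph_poly_nonzero)
  ultimately show ?thesis
    by (simp only: sum_divide_distrib divide_self simp_thms)
qed

lemma ex_resolvent_solution:
  assumes V: "finite (verts G)"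
  obtains z :: "'a \<Rightarrow> rat poly fract" where
    "\<And>v. v \<in> verts G \<Longrightarrow> to_fract [:0, 1:] * z v - (\<Sum>u\<in>nbs G v. z u) = 1"
proof -
  obtain P where
    P: "\<And>v. v \<in> verts G \<Longrightarrow> [:0, 1:] * P v = (graph_poly G :: rat poly) + (\<Sum>u\<in>nbs G v. P u)"
    using ex_coronal_numerators[OF V] by metis
  show thesis by (rule that[OF resolvent_solution[OF P]])
qed

section \<open>Walk counts from the expansion at infinity\<close>

abbreviation vdeg :: "'a sgraph \<Rightarrow> 'a \<Rightarrow> nat" where
  "vdeg G v \<equiv> card (nbs G v)"

text \<open>The first three terms of the expansion of the coronal at infinity, whose coefficients
  count the walks of length 0, 1 and 2.\<close>

lemma coronal_expansion:
  assumes V: "finite (verts G)"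
  obtains N Q where "coronal G = to_fract N / to_fract (graph_poly G)"
    and "[:0, 1:] ^ 3 * N = [:of_nat (\<Sum>v\<in>verts G. vdeg G v ^ 2),
           of_nat (\<Sum>v\<in>verts G. vdeg G v), of_nat (num_verts G):] * graph_poly G + Q"
    and "Q = 0 \<or> degree Q < num_verts G"
proof -
  let ?\<phi> = "graph_poly G :: rat poly" and ?x = "[:0, 1:] :: rat poly"
  obtain P where P: "\<And>v. v \<in> verts G \<Longrightarrow> ?x * P v = ?\<phi> + (\<Sum>u\<in>nbs G v. P u)"
    using ex_coronal_numerators[OF V] by metis
  \<comment> \<open>\<open>W\<close> is the adjacency operator on vertex weights, and
    \<open>S w\<close> pairs \<open>w\<close> with the numerators of the solution. Each use of
    \<open>step\<close> multiplies by x and splits off one walk count.\<close>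
  define W where "W w v = (\<Sum>u\<in>nbs G v. w u)" for w :: "'a \<Rightarrow> rat poly" and v
  define S where "S w = (\<Sum>v\<in>verts G. w v * P v)" for w
  have step: "?x * S w = (\<Sum>v\<in>verts G. w v) * ?\<phi> + S (W w)" for w
  proof -
    have "?x * S w = (\<Sum>v\<in>verts G. w v * (?x * P v))"
      by (simp only: S_def sum_distrib_left mult.left_commute)
    also have "\<dots> = (\<Sum>v\<in>verts G. w v * ?\<phi> + w v * (\<Sum>u\<in>nbs G v. P u))"
      by (intro sum.cong refl) (simp only: P ring_distribs)
    also have "\<dots> = (\<Sum>v\<in>verts G. w v) * ?\<phi> + (\<Sum>v\<in>verts G. w v * (\<Sum>u\<in>nbs G v. P u))"
      by (simp only: sum.distrib sum_distrib_right)
    also have "(\<Sum>v\<in>verts G. w v * (\<Sum>u\<in>nbs G v. P u)) = S (W w)"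
      unfolding S_def W_def by (rule sum_nbs_swap[OF V])
    finally show ?thesis .
  qed
  define one where "one = (\<lambda>_ :: 'a. 1 :: rat poly)"
  have W1: "W one v = of_nat (vdeg G v)" for v
    by (simp add: W_def one_def)
  have w0: "(\<Sum>v\<in>verts G. one v) = of_nat (num_verts G)"
    by (simp add: one_def num_verts_def)
  have w1: "(\<Sum>v\<in>verts G. W one v) = of_nat (\<Sum>v\<in>verts G. vdeg G v)"
    by (simp add: W1)
  \<comment> \<open>By symmetry the number of walks of length 2 is the squared norm of the vector of
    degrees.\<close>
  have "(\<Sum>v\<in>verts G. W (W one) v) = (\<Sum>v\<in>verts G. one v * (\<Sum>u\<in>nbs G v. W one u))"
    by (simp add: W_def one_def)
  also have "\<dots> = (\<Sum>v\<in>verts G. W one v * W one v)"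
    by (subst sum_nbs_swap[OF V]) (simp only: W_def)
  also have "\<dots> = of_nat (\<Sum>v\<in>verts G. vdeg G v ^ 2)"
    by (simp add: W1 power2_eq_square)
  finally have w2: "(\<Sum>v\<in>verts G. W (W one) v) = of_nat (\<Sum>v\<in>verts G. vdeg G v ^ 2)" .
  define N where "N = S one"
  define Q where "Q = S (W (W (W one)))"
  show thesis
  proof (rule that)
    show "coronal G = to_fract N / to_fract ?\<phi>"
      using coronal_eq_sum[OF V resolvent_solution[OF P]]
      by (simp add: N_def S_def one_def sum_divide_distrib)
    have "?x ^ 3 * N = ?x * (?x * (?x * S one))"
      by (simp only: N_def power3_eq_cube mult.assoc)
    also have "\<dots> = (of_nat (num_verts G) * ?x ^ 2 + of_nat (\<Sum>v\<in>verts G. vdeg G v) * ?x +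
        of_nat (\<Sum>v\<in>verts G. vdeg G v ^ 2)) * ?\<phi> + Q"
      unfolding step w0 w1 w2 Q_def ring_distribs by (simp only: power2_eq_square ac_simps)
    also have "of_nat (num_verts G) * ?x ^ 2 + of_nat (\<Sum>v\<in>verts G. vdeg G v) * ?x +
        of_nat (\<Sum>v\<in>verts G. vdeg G v ^ 2) = [:of_nat (\<Sum>v\<in>verts G. vdeg G v ^ 2),
           of_nat (\<Sum>v\<in>verts G. vdeg G v), of_nat (num_verts G):]"
      by (simp only: of_nat_poly power2_eq_square) simp
    finally show "?x ^ 3 * N = [:of_nat (\<Sum>v\<in>verts G. vdeg G v ^ 2),
           of_nat (\<Sum>v\<in>verts G. vdeg G v), of_nat (num_verts G):] * ?\<phi> + Q" .
    show "Q = 0 \<or> degree Q < num_verts G"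
    \<comment> \<open>Without vertices the strict degree bound would read 0 < 0, whence the
      alternative \<open>Q = 0\<close>.\<close>
    proof (cases "verts G = {}")
      case True
      then show ?thesis by (simp add: Q_def S_def)
    next
      case False
      \<comment> \<open>The weights stay constant polynomials under \<open>W\<close>, so they do not
        raise the degrees of the numerators.\<close>
      have W_const: "\<exists>c. W w v = [:c:]" if "\<And>u. \<exists>c. w u = [:c:]" for w v
      proof -
        from that obtain c where "w = (\<lambda>u. [:c u:])" by metis
        then have "W w v = [:\<Sum>u\<in>nbs G v. c u:]" by (simp add: W_def sum_to_poly)
        then show ?thesis ..
      qed
      have "\<exists>c. one u = [:c:]" for u by (auto simp: one_def one_pCons)
      then have const: "\<exists>c. W (W (W one)) v = [:c:]" for v
        by (intro W_const)
      have "degree (W (W (W one)) v * P v) < num_verts G" if "v \<in> verts G" for v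
      proof -
        obtain c where c: "W (W (W one)) v = [:c:]" using const by blast
        show ?thesis
          using degree_coronal_numerators[OF V P that] degree_mult_le[of "[:c:]" "P v"]
          unfolding c by simp
      qed
      then have "degree Q < num_verts G"
        unfolding Q_def S_def using False V
        by (intro degree_sum_less) (auto simp: num_verts_def card_gt_0_iff)
      then show ?thesis ..
    qed
  qed
qed

lemma degree_diff_less':
  fixes a b :: "'b :: ab_group_add poly"
  assumes "a = 0 \<or> degree a < m" "b = 0 \<or> degree b < m" "a - b \<noteq> 0"
  shows "degree (a - b) < m"
proof (cases "a = 0 \<or> b = 0")
  case True
  then show ?thesis using assms by auto
next
  case False
  then show ?thesis using assms by (intro degree_diff_less) simp_all
qed

text \<open>After cross-multiplication, \<open>s - s'\<close> times both characteristic polynomials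
  equals a polynomial of degree below that of their product, so \<open>s = s'\<close>. The vertex
  counts are themselves a conclusion, hence all bounds are in terms of their sum.\<close>

lemma coronal_eq_imp_degree_moments_eq:
  assumes "finite (verts G)" "finite (verts H)" and eq: "coronal G = coronal H"
  shows "num_verts G = num_verts H"
    and "(\<Sum>v\<in>verts G. vdeg G v) = (\<Sum>v\<in>verts H. vdeg H v)"
    and "(\<Sum>v\<in>verts G. vdeg G v ^ 2) = (\<Sum>v\<in>verts H. vdeg H v ^ 2)"
proof -
  let ?p = "graph_poly G :: rat poly" and ?q = "graph_poly H :: rat poly"
  obtain N Q s where N: "coronal G = to_fract N / to_fract ?p"
    and s: "s = [:of_nat (\<Sum>v\<in>verts G. vdeg G v ^ 2), of_nat (\<Sum>v\<in>verts G. vdeg G v),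
           of_nat (num_verts G):]"
    and NQ: "[:0, 1:] ^ 3 * N = s * ?p + Q" and Q: "Q = 0 \<or> degree Q < num_verts G"
    using coronal_expansion[OF assms(1)] by metis
  obtain N' Q' s' where N': "coronal H = to_fract N' / to_fract ?q"
    and s': "s' = [:of_nat (\<Sum>v\<in>verts H. vdeg H v ^ 2), of_nat (\<Sum>v\<in>verts H. vdeg H v),
           of_nat (num_verts H):]"
    and NQ': "[:0, 1:] ^ 3 * N' = s' * ?q + Q'" and Q': "Q' = 0 \<or> degree Q' < num_verts H"
    using coronal_expansion[OF assms(2)] by metis
  have "to_fract N * to_fract ?q = to_fract N' * to_fract ?p"
    using eq frac_eq_eq[of "to_fract ?p" "to_fract ?q" "to_fract N" "to_fract N'"]
    unfolding N N' to_fract_eq_0_iff by (simp only: graph_poly_nonzero simp_thms)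
  then have "N * ?q = N' * ?p"
    by (simp only: to_fract_mult[symmetric] to_fract_eq_iff)
  then have "([:0, 1:] ^ 3 * N) * ?q = ([:0, 1:] ^ 3 * N') * ?p"
    by (simp only: mult.assoc)
  then have *: "(s - s') * (?p * ?q) = Q' * ?p - Q * ?q"
    unfolding NQ NQ' by (simp only: ring_distribs) (simp add: algebra_simps)
  have "s - s' = 0"
  proof (rule ccontr)
    assume ne: "s - s' \<noteq> 0"
    have pq: "?p \<noteq> 0" "?q \<noteq> 0" by (simp_all add: graph_poly_nonzero)
    have "Q' * ?p = 0 \<or> degree (Q' * ?p) < num_verts G + num_verts H"
      using Q' pq by (cases "Q' = 0") (simp_all add: degree_mult_eq degree_graph_poly)
    moreover have "Q * ?q = 0 \<or> degree (Q * ?q) < num_verts G + num_verts H"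
      using Q pq by (cases "Q = 0") (simp_all add: degree_mult_eq degree_graph_poly)
    moreover have "Q' * ?p - Q * ?q \<noteq> 0"
      unfolding *[symmetric] using ne pq by simp
    ultimately have "degree (Q' * ?p - Q * ?q) < num_verts G + num_verts H"
      by (rule degree_diff_less')
    moreover have "degree ((s - s') * (?p * ?q)) \<ge> num_verts G + num_verts H"
      using ne pq by (simp add: degree_mult_eq degree_graph_poly)
    ultimately show False unfolding * by simp
  qed
  then have "s = s'" by simp
  then show "num_verts G = num_verts H"
    and "(\<Sum>v\<in>verts G. vdeg G v) = (\<Sum>v\<in>verts H. vdeg H v)"
    and "(\<Sum>v\<in>verts G. vdeg G v ^ 2) = (\<Sum>v\<in>verts H. vdeg H v ^ 2)"
    unfolding s s' by (simp_all only: pCons_eq_iff of_nat_eq_iff)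
qed

text \<open>The leading moment is the number of vertices, compared here with that of the empty
  graph. This is what keeps both factor coronals from vanishing.\<close>

lemma coronal_eq_0_iff:
  assumes "finite (verts G)"
  shows "coronal G = 0 \<longleftrightarrow> verts G = {}"
proof
  let ?E = "\<lparr>verts = {}, edges = {}\<rparr> :: 'a sgraph"
  have E: "coronal ?E = 0" by (subst coronal_eq_sum) auto
  assume "coronal G = 0"
  then have "num_verts G = num_verts ?E"
    using assms by (intro coronal_eq_imp_degree_moments_eq(1)) (simp_all add: E)
  then show "verts G = {}" using assms by (simp add: num_verts_def)
qed (subst coronal_eq_sum, auto)

section \<open>Coronals of disjoint unions\<close>

text \<open>The free endpoint makes the equivalence also say that no edge leaves its summand;
  \<open>cycle_in_component\<close> asks for exactly this form.\<close>

lemma edges_disjoint_union_iff: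
  "{Inl v, x} \<in> edges (disjoint_union R U) \<longleftrightarrow> (\<exists>u. x = Inl u \<and> {v, u} \<in> edges R)"
  "{Inr w, y} \<in> edges (disjoint_union R U) \<longleftrightarrow> (\<exists>u. y = Inr u \<and> {w, u} \<in> edges U)"
proof -
  have ll: "{Inl a, Inl b} = Inl ` e \<longleftrightarrow> e = {a, b}" for a b and e :: "'a set"
    using inj_image_eq_iff[OF inj_Inl, of "{a, b}" e] by auto
  have rr: "{Inr a, Inr b} = Inr ` e \<longleftrightarrow> e = {a, b}" for a b and e :: "'b set"
    using inj_image_eq_iff[OF inj_Inr, of "{a, b}" e] by auto
  have l: "Inl a \<notin> Inr ` e" and r: "Inr b \<notin> Inl ` e'" for a b e e' by auto
  have lx: "{Inl a, z} \<noteq> Inr ` e" "{z, Inl a} \<noteq> Inr ` e" for a z e using l by blast+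
  have rx: "{Inr a, z} \<noteq> Inl ` e" "{z, Inr a} \<noteq> Inl ` e" for a z e using r by blast+
  show "{Inl v, x} \<in> edges (disjoint_union R U) \<longleftrightarrow> (\<exists>u. x = Inl u \<and> {v, u} \<in> edges R)"
    by (cases x) (simp_all add: disjoint_union_def image_iff ll lx rx)
  show "{Inr w, y} \<in> edges (disjoint_union R U) \<longleftrightarrow> (\<exists>u. y = Inr u \<and> {w, u} \<in> edges U)"
    by (cases y) (simp_all add: disjoint_union_def image_iff rr lx rx)
qed

lemma nbs_disjoint_union:
  "nbs (disjoint_union R U) (Inl v) = Inl ` nbs R v"
  "nbs (disjoint_union R U) (Inr w) = Inr ` nbs U w"
  unfolding nbs_def edges_disjoint_union_iff by (auto simp: disjoint_union_def)

lemma verts_disjoint_union: "verts (disjoint_union R U) = Inl ` verts R \<union> Inr ` verts U"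
  by (simp add: disjoint_union_def)

text \<open>There are no edges between the summands, so solutions of the two systems combine by
  \<open>case_sum\<close> to a solution for the union.\<close>

lemma coronal_disjoint_union:
  assumes R: "finite (verts R)" and U: "finite (verts U)"
  shows "coronal (disjoint_union R U) = coronal R + coronal U"
proof -
  obtain y :: "'a \<Rightarrow> rat poly fract" where y: "\<And>v. v \<in> verts R \<Longrightarrow> to_fract [:0, 1:] * y v - (\<Sum>u\<in>nbs R v. y u) = 1"
    using ex_resolvent_solution[OF R] by blast
  obtain z :: "'b \<Rightarrow> rat poly fract" where z: "\<And>v. v \<in> verts U \<Longrightarrow> to_fract [:0, 1:] * z v - (\<Sum>u\<in>nbs U v. z u) = 1"
    using ex_resolvent_solution[OF U] by blast
  have "coronal (disjoint_union R U) = (\<Sum>v\<in>verts (disjoint_union R U). case_sum y z v)"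
  proof (rule coronal_eq_sum)
    show "finite (verts (disjoint_union R U))"
      using R U by (simp add: verts_disjoint_union)
    fix v assume "v \<in> verts (disjoint_union R U)"
    then consider a where "v = Inl a" "a \<in> verts R" | b where "v = Inr b" "b \<in> verts U"
      unfolding verts_disjoint_union by blast
    then show "to_fract [:0, 1:] * case_sum y z v -
        (\<Sum>u\<in>nbs (disjoint_union R U) v. case_sum y z u) = 1"
    proof cases
      case (1 a)
      show ?thesis
        unfolding 1(1) nbs_disjoint_union sum.reindex[OF inj_on_subset[OF inj_Inl subset_UNIV]]
          comp_def sum.case by (rule y[OF 1(2)])
    next
      case (2 b)
      show ?thesis
        unfolding 2(1) nbs_disjoint_union sum.reindex[OF inj_on_subset[OF inj_Inr subset_UNIV]]
          comp_def sum.case by (rule z[OF 2(2)])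
    qed
  qed
  also have "\<dots> = (\<Sum>v\<in>Inl ` verts R. case_sum y z v) + (\<Sum>v\<in>Inr ` verts U. case_sum y z v)"
    unfolding verts_disjoint_union using R U by (intro sum.union_disjoint) auto
  also have "\<dots> = (\<Sum>v\<in>verts R. y v) + (\<Sum>v\<in>verts U. z v)"
    unfolding sum.reindex[OF inj_on_subset[OF inj_Inl subset_UNIV]]
      sum.reindex[OF inj_on_subset[OF inj_Inr subset_UNIV]] comp_def sum.case ..
  also have "\<dots> = coronal R + coronal U"
    using coronal_eq_sum[OF R y] coronal_eq_sum[OF U z] by (simp only:)
  finally show ?thesis .
qed

section \<open>Complements\<close>

text \<open>One bordered matrix \<open>?K\<close> is factored into block triangular matrices in two
  ways: eliminating one way leaves the scalar Schur complement \<open>S\<close>, the other way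
  leaves \<open>1\<^sub>m n + Z\<close>.\<close>

lemma det_one_add_const_rows:
  fixes z :: "nat \<Rightarrow> 'b :: idom"
  shows "det (1\<^sub>m n + mat n n (\<lambda>(i, j). z i)) = 1 + (\<Sum>i<n. z i)"
proof -
  define Z where "Z = mat n n (\<lambda>(i, j :: nat). z i)"
  define c where "c = mat n 1 (\<lambda>(i, j :: nat). - z i)"
  define r where "r = mat 1 n (\<lambda>_. 1 :: 'b)"
  define S where "S = mat 1 1 (\<lambda>_. 1 + (\<Sum>i<n. z i))"
  have Z: "Z \<in> carrier_mat n n" and c: "c \<in> carrier_mat n 1" and r: "r \<in> carrier_mat 1 n"
    and S: "S \<in> carrier_mat 1 1"
    by (simp_all add: Z_def c_def r_def S_def)
  note I = one_carrier_mat[of n] one_carrier_mat[of 1] and O = zero_carrier_mat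
  note IZ = add_carrier_mat[OF Z, of "1\<^sub>m n"]
  let ?K = "four_block_mat (1\<^sub>m n) c r (1\<^sub>m 1)"
  have "four_block_mat (1\<^sub>m n) (0\<^sub>m n 1) r (1\<^sub>m 1) * four_block_mat (1\<^sub>m n) c (0\<^sub>m 1 n) S = ?K"
    unfolding mult_four_block_mat[OF I(1) O r I(2) I(1) c O S]
  proof (rule cong_four_block_mat)
    show "r * c + 1\<^sub>m 1 * S = 1\<^sub>m 1"
      by (rule eq_matI) (auto simp: r_def c_def S_def scalar_prod_def sum_negf lessThan_atLeast0)
    show "1\<^sub>m n * 1\<^sub>m n + 0\<^sub>m n 1 * 0\<^sub>m 1 n = (1\<^sub>m n :: 'b mat)"
      by (simp only: left_mult_one_mat[OF I(1)] left_mult_zero_mat[OF O] right_add_zero_mat[OF I(1)])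
    show "1\<^sub>m n * c + 0\<^sub>m n 1 * S = c"
      by (simp only: left_mult_one_mat[OF c] left_mult_zero_mat[OF S] right_add_zero_mat[OF c])
    show "r * 1\<^sub>m n + 1\<^sub>m 1 * 0\<^sub>m 1 n = r"
      by (simp only: right_mult_one_mat[OF r] left_mult_one_mat[OF O] right_add_zero_mat[OF r])
  qed
  then have "det ?K = det (four_block_mat (1\<^sub>m n) (0\<^sub>m n 1) r (1\<^sub>m 1)) *
      det (four_block_mat (1\<^sub>m n) c (0\<^sub>m 1 n) S)"
    using det_mult[OF four_block_carrier_mat[OF I(1,2)] four_block_carrier_mat[OF I(1) S]] by metis
  also have "\<dots> = det S"
    unfolding det_four_block_mat_upper_right_zero[OF I(1) refl r I(2)]
      det_four_block_mat_lower_left_zero[OF I(1) c refl S] by simp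
  finally have K: "det ?K = 1 + (\<Sum>i<n. z i)"
    unfolding det_single[OF S] by (simp add: S_def)
  have "four_block_mat (1\<^sub>m n) c (0\<^sub>m 1 n) (1\<^sub>m 1) * four_block_mat (1\<^sub>m n + Z) (0\<^sub>m n 1) r (1\<^sub>m 1) = ?K"
    unfolding mult_four_block_mat[OF I(1) c O I(2) IZ O r I(2)]
  proof (rule cong_four_block_mat)
    show "1\<^sub>m n * (1\<^sub>m n + Z) + c * r = 1\<^sub>m n"
      unfolding left_mult_one_mat[OF IZ]
      by (rule eq_matI) (auto simp: r_def c_def Z_def scalar_prod_def)
    show "1\<^sub>m n * 0\<^sub>m n 1 + c * 1\<^sub>m 1 = c"
      by (simp only: right_mult_one_mat[OF c] left_mult_one_mat[OF O] left_add_zero_mat[OF c])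
    show "0\<^sub>m 1 n * (1\<^sub>m n + Z) + 1\<^sub>m 1 * r = r"
      by (simp only: left_mult_one_mat[OF r] left_mult_zero_mat[OF IZ] left_add_zero_mat[OF r])
    show "0\<^sub>m 1 n * 0\<^sub>m n 1 + 1\<^sub>m 1 * 1\<^sub>m 1 = (1\<^sub>m 1 :: 'b mat)"
      by (simp only: left_mult_one_mat[OF I(2)] left_mult_zero_mat[OF O] left_add_zero_mat[OF I(2)])
  qed
  then have "det ?K = det (four_block_mat (1\<^sub>m n) c (0\<^sub>m 1 n) (1\<^sub>m 1)) *
      det (four_block_mat (1\<^sub>m n + Z) (0\<^sub>m n 1) r (1\<^sub>m 1))"
    using det_mult[OF four_block_carrier_mat[OF I(1,2)] four_block_carrier_mat[OF IZ I(2)]] by metis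
  also have "\<dots> = det (1\<^sub>m n + Z)"
    unfolding det_four_block_mat_upper_right_zero[OF IZ refl r I(2)]
      det_four_block_mat_lower_left_zero[OF I(1) c refl I(2)] by simp
  finally show ?thesis unfolding K Z_def ..
qed

abbreviation ones_mat :: "nat \<Rightarrow> 'b :: one mat" where
  "ones_mat n \<equiv> mat n n (\<lambda>_. 1)"

text \<open>Since \<open>B\<close> maps z to the all-one vector, the all-one matrix is
  \<open>B\<close> times the matrix whose columns are all z, and \<open>B\<close> factors out of the
  sum.\<close>

lemma det_add_ones_mat:
  fixes B :: "'b :: idom mat"
  assumes B: "B \<in> carrier_mat n n" and Bz: "B *\<^sub>v vec n z = ones_vec n"
  shows "det (B + ones_mat n) = det B * (1 + (\<Sum>i<n. z i))"
proof -
  let ?Z = "mat n n (\<lambda>(i, j). z i)"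
  have "B * ?Z = ones_mat n"
  proof (rule eq_matI)
    fix i j assume ij: "i < dim_row (ones_mat n :: 'b mat)" "j < dim_col (ones_mat n :: 'b mat)"
    have "col ?Z j = vec n z" using ij by auto
    then have "(B * ?Z) $$ (i, j) = (B *\<^sub>v vec n z) $ i" using ij B by simp
    then show "(B * ?Z) $$ (i, j) = ones_mat n $$ (i, j)"
      using ij unfolding Bz by (simp add: ones_vec_def)
  qed (use B in auto)
  then have "B + ones_mat n = B * (1\<^sub>m n + ?Z)"
    using B by (subst mult_add_distrib_mat[OF B one_carrier_mat mat_carrier]) simp
  then show ?thesis
    by (simp only: det_mult[OF B add_carrier_mat[OF mat_carrier]] det_one_add_const_rows)
qed

lemma det_resolvent_mat_add_ones:
  fixes G :: "'a sgraph"
  assumes V: "finite (verts G)"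
  shows "det (resolvent_mat G + ones_mat (num_verts G)) = to_fract (graph_poly G) * (1 + coronal G)"
proof -
  obtain z :: "'a \<Rightarrow> rat poly fract" where
    z: "\<And>v. v \<in> verts G \<Longrightarrow> to_fract [:0, 1:] * z v - (\<Sum>u\<in>nbs G v. z u) = 1"
    using ex_resolvent_solution[OF V] by blast
  have "coronal G = (\<Sum>i<num_verts G. z (vertex_enum G ! i))"
    using coronal_eq_sum[OF V z] sum_vertex_enum[OF V, of z] by (simp only: lessThan_atLeast0)
  then show ?thesis
    by (simp only: det_add_ones_mat[OF resolvent_mat_carrier resolvent_mat_mult_solution[OF V z]]
        det_resolvent_mat)
qed

lemma det_char_poly_matrix_add_ones:
  assumes "simple_graph G"
  shows "to_fract (det (char_poly_matrix (adj_matrix G) + ones_mat (num_verts G))) =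
    to_fract (graph_poly G) * (1 + coronal G)"
proof -
  interpret comm_ring_hom "to_fract :: rat poly \<Rightarrow> rat poly fract"
    by (rule comm_ring_hom_to_fract)
  have "map_mat to_fract (char_poly_matrix (adj_matrix G) + ones_mat (num_verts G)) =
      resolvent_mat G + ones_mat (num_verts G)"
    by (rule eq_matI) (auto simp: char_poly_matrix_def adj_matrix_def)
  then have "to_fract (det (char_poly_matrix (adj_matrix G) + ones_mat (num_verts G))) =
      det (resolvent_mat G + ones_mat (num_verts G))"
    by (simp only: hom_det[symmetric])
  then show ?thesis
    using assms det_resolvent_mat_add_ones[of G] by (simp only: simple_graph_def)
qed

text \<open>The complement has adjacency matrix J - I - A, and xI - (J - I - A) = -((-1 - x)I - A +
  J). Hence the substitution of -1 - x for x and one sign per row.\<close>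

lemma graph_poly_complement:
  assumes "simple_graph G"
  shows "graph_poly (complement G) = (- 1) ^ num_verts G *
    (det (char_poly_matrix (adj_matrix G) + ones_mat (num_verts G)) \<circ>\<^sub>p [:- 1, - 1 :: rat:])"
proof -
  let ?n = "num_verts G" and ?p = "[:- 1, - 1 :: rat:]"
  let ?M = "char_poly_matrix (adj_matrix G) + ones_mat (num_verts G) :: rat poly mat"
  have V: "finite (verts G)"
    and E: "edges G \<subseteq> {{u, v} | u v. u \<in> verts G \<and> v \<in> verts G \<and> u \<noteq> v}"
    using assms by (auto simp: simple_graph_def)
  have n: "num_verts (complement G) = ?n" and e: "vertex_enum (complement G) = vertex_enum G"
    by (simp_all add: complement_def num_verts_def vertex_enum_def)
  have "char_poly_matrix (adj_matrix (complement G)) = (- 1) \<cdot>\<^sub>m map_mat (\<lambda>q. q \<circ>\<^sub>p ?p) ?M"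
  proof (rule eq_matI)
    fix i j assume "i < dim_row ((- 1) \<cdot>\<^sub>m map_mat (\<lambda>q. q \<circ>\<^sub>p ?p) ?M)"
      and "j < dim_col ((- 1) \<cdot>\<^sub>m map_mat (\<lambda>q. q \<circ>\<^sub>p ?p) ?M)"
    then have ij: "i < ?n" "j < ?n" by simp_all
    let ?u = "vertex_enum G ! i" and ?v = "vertex_enum G ! j"
    have uv: "?u \<in> verts G" "?v \<in> verts G"
      using ij nth_mem[of _ "vertex_enum G"] unfolding vertex_enum[OF V] by blast+
    have "?u = ?v \<longleftrightarrow> i = j"
      using ij nth_eq_iff_index_eq[OF distinct_vertex_enum[OF V]] length_vertex_enum[OF V] by simp
    moreover have "{?u, ?v} \<in> edges (complement G) \<longleftrightarrow> ?u \<noteq> ?v \<and> {?u, ?v} \<notin> edges G"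
      using uv by (auto simp: complement_def doubleton_eq_iff)
    moreover have "{?v} \<notin> edges G"
      using E by (auto dest!: subsetD)
    ultimately show "char_poly_matrix (adj_matrix (complement G)) $$ (i, j) =
        ((- 1) \<cdot>\<^sub>m map_mat (\<lambda>q. q \<circ>\<^sub>p ?p) ?M) $$ (i, j)"
      using ij by (simp add: char_poly_matrix_def adj_matrix_def n e pcompose_pCons one_pCons)
  qed (simp_all add: char_poly_matrix_def adj_matrix_def n)
  then have "graph_poly (complement G) = det ((- 1) \<cdot>\<^sub>m map_mat (\<lambda>q. q \<circ>\<^sub>p ?p) ?M)"
    by (simp only: graph_poly_def char_poly_def)
  also have "\<dots> = (- 1) ^ ?n * (det ?M \<circ>\<^sub>p ?p)"
    unfolding det_smult comm_ring_hom.hom_det[OF pcompose_hom.comm_ring_hom_axioms] by simp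
  finally show ?thesis .
qed

lemma graph_poly_complement_cong:
  assumes G: "simple_graph G" and H: "simple_graph H"
    and \<phi>: "graph_poly G = (graph_poly H :: rat poly)" and \<Gamma>: "coronal G = coronal H"
  shows "graph_poly (complement G) = (graph_poly (complement H) :: rat poly)"
proof -
  have n: "num_verts G = num_verts H"
    using degree_graph_poly[of G, where ?'b = rat] degree_graph_poly[of H, where ?'b = rat] \<phi>
    by simp
  have "to_fract (det (char_poly_matrix (adj_matrix G) + ones_mat (num_verts G))) =
      to_fract (det (char_poly_matrix (adj_matrix H) + ones_mat (num_verts H)) :: rat poly)"
    unfolding det_char_poly_matrix_add_ones[OF G] det_char_poly_matrix_add_ones[OF H] \<phi> \<Gamma> ..
  then have "det (char_poly_matrix (adj_matrix G) + ones_mat (num_verts G)) =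
      (det (char_poly_matrix (adj_matrix H) + ones_mat (num_verts H)) :: rat poly)"
    unfolding to_fract_eq_iff .
  then show ?thesis
    by (simp only: graph_poly_complement[OF G] graph_poly_complement[OF H] n)
qed

lemma generalized_cospectralI:
  assumes "simple_graph G" "simple_graph H"
    and "graph_poly G = (graph_poly H :: rat poly)" and "coronal G = coronal H"
  shows "generalized_cospectral G H"
proof -
  have hom: "comm_ring_hom (of_rat :: rat \<Rightarrow> complex)"
    by unfold_locales (simp_all add: of_rat_add of_rat_mult)
  have "graph_poly G = (graph_poly H :: complex poly)"
    using arg_cong[OF assms(3), of "map_poly (of_rat :: rat \<Rightarrow> complex)"] unfolding graph_poly_hom[OF hom] .
  moreover have "graph_poly (complement G) = (graph_poly (complement H) :: complex poly)"
    using arg_cong[OF graph_poly_complement_cong[OF assms], of "map_poly (of_rat :: rat \<Rightarrow> complex)"]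
    unfolding graph_poly_hom[OF hom] .
  ultimately show ?thesis
    unfolding generalized_cospectral_def adj_spectrum_def by (simp only: simp_thms)
qed

section \<open>Matchings and involutions\<close>

text \<open>These are the permutations whose term in the expansion of det(xI - A) survives: a moved
  vertex selects an off-diagonal entry, which is nonzero only along an edge.\<close>

definition edge_perms :: "'a sgraph \<Rightarrow> ('a \<Rightarrow> 'a) set" where
  "edge_perms G = {p. p permutes verts G \<and> (\<forall>v. p v \<noteq> v \<longrightarrow> {v, p v} \<in> edges G)}"

text \<open>The surviving term itself: each moved vertex contributes -1 and each fixed vertex
  x.\<close>

definition perm_weight :: "'a sgraph \<Rightarrow> ('a \<Rightarrow> 'a) \<Rightarrow> rat poly" where
  "perm_weight G p = of_int (sign p) * (- 1) ^ card {v. p v \<noteq> v} *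
     monom 1 (num_verts G - card {v. p v \<noteq> v})"

lemma finite_edge_perms: "finite (verts G) \<Longrightarrow> finite (edge_perms G)"
  using finite_permutations[of "verts G"] by (rule rev_finite_subset) (auto simp: edge_perms_def)

text \<open>Permutations of indices are transported along the vertex enumeration together with their
  signs, so that the combinatorics can take place on vertices.\<close>

lemma graph_poly_eq_sum_permutes:
  assumes V: "finite (verts G)"
  shows "graph_poly G = (\<Sum>p | p permutes verts G. of_int (sign p) *
    (\<Prod>v\<in>verts G. (if p v = v then [:0, 1:] else 0) - (if {v, p v} \<in> edges G then 1 else 0 :: rat poly)))"
proof -
  let ?n = "num_verts G" and ?e = "(!) (vertex_enum G)"
  let ?M = "char_poly_matrix (adj_matrix G) :: rat poly mat"
  let ?w = "\<lambda>v u. (if u = v then [:0, 1:] else 0) - (if {v, u} \<in> edges G then 1 else 0 :: rat poly)"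
  let ?g = "\<lambda>q. of_int (sign q) * (\<Prod>v\<in>verts G. ?w v (q v))"
  have bij: "bij_betw ?e {0..<?n} (verts G)" by (rule bij_betw_vertex_enum[OF V])
  have im: "?e ` {0..<?n} = verts G" using bij by (rule bij_betw_imp_surj_on)
  have inj: "inj_on ?e {0..<?n}" using bij by (rule bij_betw_imp_inj_on)
  have bij': "bij_betw (map_permutation {0..<?n} ?e) {p. p permutes {0..<?n}} {p. p permutes verts G}"
    using bij_betw_permutations[OF bij] unfolding map_permutation_def restrict_id_def im comp_def .
  have "graph_poly G = (\<Sum>p | p permutes {0..<?n}. of_int (sign p) * (\<Prod>i = 0..<?n. ?M $$ (i, p i)))"
    unfolding graph_poly_def char_poly_def
    by (rule det_def'[OF char_poly_matrix_closed[OF adj_matrix_carrier]])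
  also have "\<dots> = (\<Sum>p | p permutes {0..<?n}. ?g (map_permutation {0..<?n} ?e p))"
  proof (rule sum.cong[OF refl])
    fix p assume "p \<in> {p. p permutes {0..<?n}}"
    then have p: "p permutes {0..<?n}" by simp
    let ?q = "map_permutation {0..<?n} ?e p"
    have "(\<Prod>v\<in>verts G. ?w v (?q v)) = (\<Prod>i = 0..<?n. ?w (?e i) (?q (?e i)))"
      by (rule prod.reindex_bij_betw[OF bij, symmetric])
    also have "\<dots> = (\<Prod>i = 0..<?n. ?M $$ (i, p i))"
    proof (rule prod.cong[OF refl])
      fix i assume i: "i \<in> {0..<?n}"
      then have pi: "p i \<in> {0..<?n}" using permutes_in_image[OF p] by blast
      have q: "?q (?e i) = ?e (p i)" by (rule map_permutation_apply[OF inj i])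
      have eq: "?e (p i) = ?e i \<longleftrightarrow> p i = i" by (rule inj_on_eq_iff[OF inj pi i])
      show "?w (?e i) (?q (?e i)) = ?M $$ (i, p i)"
        using i pi unfolding q eq
        by (auto simp: char_poly_matrix_def adj_matrix_def one_pCons)
    qed
    finally show "of_int (sign p) * (\<Prod>i = 0..<?n. ?M $$ (i, p i)) = ?g ?q"
      by (simp only: sign_map_permutation[OF inj p finite_atLeastLessThan])
  qed
  also have "\<dots> = (\<Sum>q | q permutes verts G. ?g q)"
    by (rule sum.reindex_bij_betw[OF bij'])
  finally show ?thesis .
qed

lemma simple_graphD:
  assumes "simple_graph G"
  shows "finite (verts G)" "{v} \<notin> edges G"
    "{u, v} \<in> edges G \<Longrightarrow> u \<in> verts G \<and> v \<in> verts G \<and> u \<noteq> v"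
    "e \<in> edges G \<Longrightarrow> \<exists>u v. e = {u, v} \<and> u \<in> verts G \<and> v \<in> verts G \<and> u \<noteq> v"
    "finite (edges G)"
proof -
  show V: "finite (verts G)"
    using assms by (simp add: simple_graph_def)
  have E: "edges G \<subseteq> {{u, v} | u v. u \<in> verts G \<and> v \<in> verts G \<and> u \<noteq> v}"
    using assms by (simp add: simple_graph_def)
  show "{v} \<notin> edges G" using E by (auto dest!: subsetD)
  show "{u, v} \<in> edges G \<Longrightarrow> u \<in> verts G \<and> v \<in> verts G \<and> u \<noteq> v"
    using E by (auto dest!: subsetD simp: doubleton_eq_iff)
  show "e \<in> edges G \<Longrightarrow> \<exists>u v. e = {u, v} \<and> u \<in> verts G \<and> v \<in> verts G \<and> u \<noteq> v"
    using E by (auto dest!: subsetD)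
  have "edges G \<subseteq> Pow (verts G)" using E by (auto dest!: subsetD)
  then show "finite (edges G)" using V by (meson finite_Pow_iff finite_subset)
qed

lemma permutes_support:
  assumes "p permutes A"
  shows "{v. p v \<noteq> v} \<subseteq> A"
  using permutes_not_in[OF assms] by blast

lemma graph_poly_eq_sum_edge_perms:
  assumes G: "simple_graph G"
  shows "graph_poly G = (\<Sum>p\<in>edge_perms G. perm_weight G p)"
proof -
  let ?w = "\<lambda>v u. (if u = v then [:0, 1:] else 0) - (if {v, u} \<in> edges G then 1 else 0 :: rat poly)"
  note V = simple_graphD(1)[OF G]
  have zero: "(\<Prod>v\<in>verts G. ?w v (p v)) = 0"
    if p: "p permutes verts G" and ne: "p \<notin> edge_perms G" for p
  proof -
    obtain v where v: "p v \<noteq> v" "{v, p v} \<notin> edges G"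
      using p ne unfolding edge_perms_def by blast
    moreover have "v \<in> verts G" using permutes_support[OF p] v(1) by blast
    ultimately show ?thesis using V by (intro prod_zero) auto
  qed
  have weight: "of_int (sign p) * (\<Prod>v\<in>verts G. ?w v (p v)) = perm_weight G p"
    if p: "p \<in> edge_perms G" for p
  proof -
    have per: "p permutes verts G" using p by (simp add: edge_perms_def)
    have supp: "verts G \<inter> - {v. p v = v} = {v. p v \<noteq> v}"
      using permutes_support[OF per] by auto
    have fixed: "verts G \<inter> {v. p v = v} = verts G - {v. p v \<noteq> v}" by auto
    have "(\<Prod>v\<in>verts G. ?w v (p v)) = (\<Prod>v\<in>verts G. if p v = v then [:0, 1:] else - 1)"
      using p simple_graphD(2)[OF G] by (intro prod.cong refl) (auto simp: edge_perms_def)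
    also have "\<dots> = [:0, 1:] ^ card (verts G \<inter> {v. p v = v}) * (- 1) ^ card {v. p v \<noteq> v}"
      using V by (simp add: prod.If_cases supp)
    also have "[:0, 1:] ^ card (verts G \<inter> {v. p v = v}) =
        (monom 1 (num_verts G - card {v. p v \<noteq> v}) :: rat poly)"
      unfolding fixed card_Diff_subset[OF finite_subset[OF permutes_support[OF per] V] permutes_support[OF per]]
      by (simp add: x_as_monom monom_power num_verts_def)
    finally show ?thesis by (simp add: perm_weight_def ac_simps)
  qed
  have "graph_poly G = (\<Sum>p\<in>edge_perms G. of_int (sign p) * (\<Prod>v\<in>verts G. ?w v (p v)))"
    unfolding graph_poly_eq_sum_permutes[OF V]
    by (rule sum.mono_neutral_right) (use V zero in \<open>auto simp: finite_permutations edge_perms_def\<close>)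
  then show ?thesis by (simp add: weight)
qed

definition matchings :: "'a sgraph \<Rightarrow> 'a set set set" where
  "matchings G = {M. M \<subseteq> edges G \<and> disjoint M}"

text \<open>Truncated subtraction is harmless, since a matching covers \<open>2 * card M\<close>
  different vertices.\<close>

definition matching_poly :: "'a sgraph \<Rightarrow> rat poly" where
  "matching_poly G = (\<Sum>M\<in>matchings G. (- 1) ^ card M * monom 1 (num_verts G - 2 * card M))"

definition edge_involutions :: "'a sgraph \<Rightarrow> ('a \<Rightarrow> 'a) set" where
  "edge_involutions G = {p \<in> edge_perms G. \<forall>v. p (p v) = v}"

text \<open>For a matching \<open>M\<close>, the default \<open>v\<close> at an uncovered vertex
  makes \<open>mate M\<close> a permutation whose two-element orbits are the edges of
  \<open>M\<close>.\<close>

definition mate :: "'a set set \<Rightarrow> 'a \<Rightarrow> 'a" where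
  "mate M v = (if \<exists>u. u \<noteq> v \<and> {v, u} \<in> M then THE u. u \<noteq> v \<and> {v, u} \<in> M else v)"

lemma finite_matchings: "simple_graph G \<Longrightarrow> finite (matchings G)"
  using simple_graphD(5)[of G] by (simp add: matchings_def)

lemma mate_eq:
  assumes M: "disjoint M" and uv: "u \<noteq> v" "{v, u} \<in> M"
  shows "mate M v = u"
proof -
  have unique: "u' = u" if u': "u' \<noteq> v" "{v, u'} \<in> M" for u'
  proof -
    have "{v, u} = {v, u'}"
    proof (rule ccontr)
      assume "{v, u} \<noteq> {v, u'}"
      from disjointD[OF M uv(2) u'(2) this] show False by simp
    qed
    then show ?thesis using uv u' by (auto simp: doubleton_eq_iff)
  qed
  have "(THE u. u \<noteq> v \<and> {v, u} \<in> M) = u"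
    by (rule the_equality, rule conjI[OF uv], elim conjE, rule unique)
  moreover have "\<exists>u. u \<noteq> v \<and> {v, u} \<in> M" using uv by blast
  ultimately show ?thesis unfolding mate_def by (simp only: if_True)
qed

lemma mate_neq_imp:
  assumes M: "disjoint M" and v: "mate M v \<noteq> v"
  shows "{v, mate M v} \<in> M"
proof -
  obtain u where u: "u \<noteq> v" "{v, u} \<in> M"
    using v by (auto simp: mate_def split: if_splits)
  then show ?thesis using mate_eq[OF M u] by simp
qed

lemma mate_mate:
  assumes M: "disjoint M"
  shows "mate M (mate M v) = v"
proof (cases "mate M v = v")
  case False
  then have "{mate M v, v} \<in> M" using mate_neq_imp[OF M] by (simp add: insert_commute)
  then show ?thesis using mate_eq[OF M, of v "mate M v"] False by simp
qed simp

text \<open>The inverse map collects the two-element orbits of an involution; they are edges since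
  each moved vertex is joined to its image.\<close>

lemma bij_betw_mate:
  assumes G: "simple_graph G"
  shows "bij_betw mate (matchings G) (edge_involutions G)"
proof (rule bij_betw_byWitness[where f' = "\<lambda>p. {{v, p v} | v. p v \<noteq> v}"])
  show "\<forall>M\<in>matchings G. {{v, mate M v} | v. mate M v \<noteq> v} = M"
  proof
    fix M assume "M \<in> matchings G"
    then have M: "disjoint M" "M \<subseteq> edges G" by (auto simp: matchings_def)
    show "{{v, mate M v} | v. mate M v \<noteq> v} = M"
    proof (intro equalityI subsetI)
      fix e assume e: "e \<in> M"
      then obtain u v where uv: "e = {v, u}" "u \<noteq> v" using simple_graphD(4)[OF G] M by blast
      then have "mate M v = u" using mate_eq[OF M(1) uv(2)] e by simp
      then have "e = {v, mate M v}" "mate M v \<noteq> v" using uv by simp_all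
      then show "e \<in> {{v, mate M v} | v. mate M v \<noteq> v}" by blast
    qed (use mate_neq_imp[OF M(1)] in blast)
  qed
  show "\<forall>p\<in>edge_involutions G. mate {{v, p v} | v. p v \<noteq> v} = p"
  proof
    fix p assume "p \<in> edge_involutions G"
    then have inv: "p (p v) = v" for v by (simp add: edge_involutions_def)
    show "mate {{v, p v} | v. p v \<noteq> v} = p"
    proof
      fix v
      have "{v, u} \<in> {{v, p v} | v. p v \<noteq> v} \<and> u \<noteq> v \<longleftrightarrow> u = p v \<and> u \<noteq> v" for u
      proof
        assume "{v, u} \<in> {{v, p v} | v. p v \<noteq> v} \<and> u \<noteq> v"
        then obtain w where "{v, u} = {w, p w}" "u \<noteq> v" by blast
        then show "u = p v \<and> u \<noteq> v" using inv[of w] by (auto simp: doubleton_eq_iff)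
      next
        assume "u = p v \<and> u \<noteq> v"
        then have u: "u = p v" "p v \<noteq> v" by auto
        have "{v, p v} \<in> {{v, p v} | v. p v \<noteq> v}"
          using u(2) by (intro CollectI exI[of _ v] conjI refl)
        then show "{v, u} \<in> {{v, p v} | v. p v \<noteq> v} \<and> u \<noteq> v"
          using u(2) unfolding u(1) ..
      qed
      then have *: "(u \<noteq> v \<and> {v, u} \<in> {{v, p v} | v. p v \<noteq> v}) = (u = p v \<and> u \<noteq> v)" for u
        by (simp only: conj_commute)
      show "mate {{v, p v} | v. p v \<noteq> v} v = p v"
        unfolding mate_def * by (cases "p v = v") (auto intro: the_equality)
    qed
  qed
  show "mate ` matchings G \<subseteq> edge_involutions G"
  proof (rule image_subsetI)
    fix M assume "M \<in> matchings G"
    then have M: "disjoint M" "M \<subseteq> edges G" by (auto simp: matchings_def)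
    have edge: "{v, mate M v} \<in> edges G" if "mate M v \<noteq> v" for v
      using mate_neq_imp[OF M(1) that] M(2) by blast
    have "mate M permutes verts G"
      unfolding permutes_def
    proof (intro conjI allI impI)
      fix v show "v \<notin> verts G \<Longrightarrow> mate M v = v"
        using edge simple_graphD(3)[OF G] by blast
      show "\<exists>!u. mate M u = v"
        using mate_mate[OF M(1)] by metis
    qed
    then show "mate M \<in> edge_involutions G"
      using edge mate_mate[OF M(1)] by (simp add: edge_involutions_def edge_perms_def)
  qed
  show "(\<lambda>p. {{v, p v} | v. p v \<noteq> v}) ` edge_involutions G \<subseteq> matchings G"
  proof (rule image_subsetI)
    fix p assume p: "p \<in> edge_involutions G"
    then have inv: "p (p v) = v" for v by (simp add: edge_involutions_def)
    have *: "{v, p v} \<inter> {w, p w} = {}" if "{v, p v} \<noteq> {w, p w}" for v w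
    proof (rule ccontr)
      assume "{v, p v} \<inter> {w, p w} \<noteq> {}"
      then consider "v = w" | "v = p w" | "p v = w" | "p v = p w" by blast
      then have "v = w \<or> v = p w" using inv by cases (metis+)
      then have "{v, p v} = {w, p w}" using inv by auto
      with that show False ..
    qed
    have "disjoint {{v, p v} | v. p v \<noteq> v}"
      by (rule disjointI) (use * in \<open>auto simp del: Int_insert_left Int_insert_right\<close>)
    then show "{{v, p v} | v. p v \<noteq> v} \<in> matchings G"
      using p by (auto simp: matchings_def edge_involutions_def edge_perms_def)
  qed
qed

text \<open>Every edge contributes one transposition. The hypotheses speak of a set of pairs alone,
  so that they pass to subsets in the induction.\<close>

lemma sign_mate:
  assumes "finite M" "disjoint M" "\<And>e. e \<in> M \<Longrightarrow> \<exists>u v. e = {u, v} \<and> u \<noteq> v"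
  shows "permutation (mate M) \<and> sign (mate M) = (- 1) ^ card M"
  using assms
proof (induction M rule: finite_induct)
  case empty
  have "mate {} = (id :: 'a \<Rightarrow> 'a)" by (auto simp: mate_def)
  then show ?case by simp
next
  case (insert e M)
  obtain a b where e: "e = {a, b}" "a \<noteq> b" using insert.prems(2) by blast
  have M: "disjoint M"
    using insert.prems(1) by (auto simp: disjoint_def)
  have ab: "{a, x} \<notin> M" "{b, x} \<notin> M" "{x, a} \<notin> M" "{x, b} \<notin> M" for x
  proof -
    have "e \<inter> f = {}" if "f \<in> M" for f
      using disjointD[OF insert.prems(1), of e f] insert.hyps(2) that by auto
    then show "{a, x} \<notin> M" "{b, x} \<notin> M" "{x, a} \<notin> M" "{x, b} \<notin> M"
      unfolding e by blast+
  qed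
  have fixed: "mate M a = a" "mate M b = b"
    using ab by (auto simp: mate_def)
  \<comment> \<open>Both ends of the new edge are fixed by \<open>mate M\<close>, so the two factors
    have disjoint supports.\<close>
  have "mate (insert e M) = transpose a b \<circ> mate M"
  proof
    fix v
    show "mate (insert e M) v = (transpose a b \<circ> mate M) v"
    proof (cases "mate M v = v")
      case True
      show ?thesis
      proof (cases "v = a \<or> v = b")
        case True
        then show ?thesis
          using mate_eq[OF insert.prems(1), of b a] mate_eq[OF insert.prems(1), of a b] e fixed
          by (auto simp: insert_commute)
      next
        case False
        have "mate (insert e M) v = v"
        proof (rule ccontr)
          assume *: "mate (insert e M) v \<noteq> v"
          with mate_neq_imp[OF insert.prems(1) this] have "{v, mate (insert e M) v} \<in> M"
            using False by (auto simp: e doubleton_eq_iff)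
          with mate_eq[OF M *] * True show False by simp
        qed
        then show ?thesis using True False by simp
      qed
    next
      case False
      then have "{v, mate M v} \<in> M" by (rule mate_neq_imp[OF M])
      then have "mate (insert e M) v = mate M v" "mate M v \<noteq> a" "mate M v \<noteq> b"
        using mate_eq[OF insert.prems(1) False] ab by auto
      then show ?thesis by simp
    qed
  qed
  moreover have IH: "permutation (mate M)" "sign (mate M) = (- 1) ^ card M"
    using insert.IH[OF M] insert.prems(2) by blast+
  moreover have "sign (transpose a b \<circ> mate M) = - ((- 1) ^ card M)"
    unfolding sign_compose[OF permutation_swap_id IH(1)] IH(2) using e(2) by (simp add: sign_swap_id)
  ultimately show ?case
    using insert.hyps permutation_compose[OF permutation_swap_id IH(1), of a b]
    by (simp only: card_insert_disjoint power_Suc) simp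
qed

lemma card_mate_support:
  assumes G: "simple_graph G" and M: "M \<in> matchings G"
  shows "card {v. mate M v \<noteq> v} = 2 * card M"
proof -
  have M': "disjoint M" "M \<subseteq> edges G" using M by (auto simp: matchings_def)
  have card2: "card e = 2 \<and> finite e" if "e \<in> M" for e
    using simple_graphD(4)[OF G] M'(2) that by (metis card_2_iff finite.emptyI finite_insert subsetD)
  have "{v. mate M v \<noteq> v} = \<Union> M"
  proof (intro equalityI subsetI)
    fix v assume "v \<in> \<Union> M"
    then obtain e where e: "e \<in> M" "v \<in> e" by blast
    then obtain a b where ab: "e = {a, b}" "a \<noteq> b"
      using simple_graphD(4)[OF G] M'(2) by blast
    then have "mate M a = b" "mate M b = a"
      using mate_eq[OF M'(1)] e(1) by (auto simp: insert_commute)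
    then show "v \<in> {v. mate M v \<noteq> v}" using e(2) ab by auto
  qed (use mate_neq_imp[OF M'(1)] in blast)
  then have "card {v. mate M v \<noteq> v} = (\<Sum>e\<in>M. card e)"
    using M'(1) card2 by (simp add: card_Union_disjoint)
  also have "\<dots> = 2 * card M" using card2 by simp
  finally show ?thesis .
qed

lemma perm_weight_mate:
  assumes G: "simple_graph G" and M: "M \<in> matchings G"
  shows "perm_weight G (mate M) = (- 1) ^ card M * monom 1 (num_verts G - 2 * card M)"
proof -
  have "finite M" "disjoint M" "\<And>e. e \<in> M \<Longrightarrow> \<exists>u v. e = {u, v} \<and> u \<noteq> v"
    using M simple_graphD(4)[OF G] finite_subset[OF _ simple_graphD(5)[OF G]]
    by (auto simp: matchings_def) blast
  from sign_mate[OF this] show ?thesis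
    by (simp add: perm_weight_def card_mate_support[OF assms])
qed

lemma sum_edge_involutions:
  assumes "simple_graph G"
  shows "(\<Sum>p\<in>edge_involutions G. perm_weight G p) = matching_poly G"
  unfolding matching_poly_def sum.reindex_bij_betw[OF bij_betw_mate[OF assms], symmetric]
  using perm_weight_mate[OF assms] by simp

section \<open>Graphs with at most one cycle\<close>

text \<open>The cycle is the orbit of \<open>v\<close>, whose length is neither 1 nor 2 because
  \<open>p (p v) \<noteq> v\<close>. The last property records that \<open>p\<close> runs around it
  without turning back.\<close>

lemma cycle_of_edge_perm:
  assumes G: "simple_graph G" and p: "p \<in> edge_perms G" and v: "p (p v) \<noteq> v"
  obtains D where "cycle_of D G" "v \<in> verts D"
    "\<And>w. w \<in> verts D \<Longrightarrow> p w \<in> verts D \<and> {w, p w} \<in> edges D \<and> p (p w) \<noteq> w"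
proof -
  have per: "p permutes verts G" and edge: "\<And>w. p w \<noteq> w \<Longrightarrow> {w, p w} \<in> edges G"
    using p by (auto simp: edge_perms_def)
  have perm: "permutation p"
    using per simple_graphD(1)[OF G] by (auto simp: permutation_permutes)
  have inj: "inj p" using per by (rule permutes_inj)
  define m where "m = least_power p v"
  define vs where "vs = support p v"
  have m: "(p ^^ m) v = v" "m > 0"
    unfolding m_def using least_power_of_permutation[OF perm] by auto
  have "m \<noteq> 1" "m \<noteq> 2"
    using m(1) v by (auto simp: numeral_2_eq_2)
  with m(2) have m3: "m \<ge> 3" by simp
  have len: "length vs = m" and nth: "\<And>i. i < m \<Longrightarrow> vs ! i = (p ^^ i) v"
    by (simp_all add: vs_def m_def)
  have dist: "distinct vs"
    unfolding vs_def by (rule cycle_of_permutation[OF perm])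
  have next_nth: "vs ! (Suc i mod m) = p (vs ! i)" if "i < m" for i
  proof (cases "Suc i = m")
    case True
    then show ?thesis using m nth[OF m(2)] nth[OF that] by (metis funpow.simps(2) funpow_0 mod_self o_apply)
  next
    case False
    then have "Suc i < m" using that by simp
    then show ?thesis using nth that by simp
  qed
  define D where "D = \<lparr>verts = set vs, edges = {{vs ! i, vs ! (Suc i mod length vs)} | i. i < length vs}\<rparr>"
  have D: "verts D = set vs" "edges D = {{vs ! i, p (vs ! i)} | i. i < m}"
    using next_nth by (auto simp: D_def len)
  \<comment> \<open>\<open>p\<close> commutes with its powers, so an orbit point returning after two
    steps would force \<open>v\<close> to return as well.\<close>
  have moved: "p (p w) \<noteq> w" if w: "w \<in> set vs" for w
  proof
    assume eq: "p (p w) = w"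
    obtain i where i: "w = (p ^^ i) v" using w by (auto simp: vs_def)
    have "(p ^^ i) (p (p v)) = p (p ((p ^^ i) v))"
      by (metis funpow_swap1)
    also have "\<dots> = (p ^^ i) v" using eq i by simp
    finally have "p (p v) = v" using inj_fn[OF inj, of i] by (simp only: inj_eq)
    with v show False ..
  qed
  have moved1: "p w \<noteq> w" if "w \<in> set vs" for w
    using moved[OF that] by metis
  have cycle: "cycle_of D G"
    unfolding cycle_of_def
  proof
    show "cycle_graph D"
      unfolding cycle_graph_def using dist m3 len by (intro exI[of _ vs]) (simp add: D_def)
    have "w \<in> verts G" if "w \<in> set vs" for w
      using edge[OF moved1[OF that]] simple_graphD(3)[OF G] by blast
    moreover have "{vs ! i, p (vs ! i)} \<in> edges G" if "i < m" for i
      using edge[OF moved1] that len by simp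
    ultimately show "subgraph D G"
      unfolding subgraph_def D by blast
  qed
  have "p w \<in> verts D \<and> {w, p w} \<in> edges D \<and> p (p w) \<noteq> w" if "w \<in> verts D" for w
  proof -
    obtain i where i: "i < m" "w = vs ! i"
      using \<open>w \<in> verts D\<close> unfolding D(1) in_set_conv_nth len by blast
    have "p w \<in> set vs"
      using next_nth[OF i(1)] nth_mem[of "Suc i mod m" vs] m(2) unfolding i(2) len by simp
    then show ?thesis
      using i(1) moved[of w] that unfolding D i(2) by blast
  qed
  moreover have "v \<in> verts D"
    using nth[OF m(2)] nth_mem[of 0 vs] m(2) by (simp add: D len)
  ultimately show thesis using that[OF cycle] by blast
qed

lemma sign_cycle_of_list:
  assumes "distinct cs"
  shows "sign (cycle_of_list cs) = (- 1) ^ (length cs - 1)"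
  using assms
proof (induction cs rule: cycle_of_list.induct)
  case (1 i j cs)
  then have "i \<noteq> j" "sign (cycle_of_list (j # cs)) = (- 1) ^ length cs" by simp_all
  then have "sign (transpose i j \<circ> cycle_of_list (j # cs)) = - ((- 1) ^ length cs)"
    unfolding sign_compose[OF permutation_swap_id permutation_of_cycle] by (simp add: sign_swap_id)
  moreover have "length (i # j # cs) - 1 = Suc (length cs)" by simp
  ultimately show ?case
    by (simp only: cycle_of_list.simps(1) power_Suc mult_minus1)
qed simp_all

text \<open>The list encoding is traded for a rotation \<open>c\<close>, which spares later
  arguments the index arithmetic modulo the length. Transitivity is what spreads a local choice
  around the cycle.\<close>

lemma cycle_graph_rotation:
  assumes "cycle_graph C"
  obtains c where "c permutes verts C" "finite (verts C)" "verts C \<noteq> {}"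
    "sign c = (- 1) ^ (num_verts C - 1)"
    "edges C = {{w, c w} | w. w \<in> verts C}"
    "\<forall>w\<in>verts C. c (c w) \<noteq> w" "\<forall>u\<in>verts C. \<forall>w\<in>verts C. \<exists>k. w = (c ^^ k) u"
proof -
  obtain vs where vs: "distinct vs" "3 \<le> length vs" "verts C = set vs"
    "edges C = {{vs ! i, vs ! (Suc i mod length vs)} | i. i < length vs}"
    using assms by (auto simp: cycle_graph_def)
  define m where "m = length vs"
  define c where "c = cycle_of_list vs"
  have pow: "(c ^^ k) (vs ! i) = vs ! ((k + i) mod m)" if "i < m" for i k
  proof -
    have "(c ^^ k) (vs ! i) = map (c ^^ k) vs ! i" using that by (simp add: m_def)
    also have "\<dots> = rotate k vs ! i" unfolding c_def cyclic_rotation[OF vs(1)] ..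
    also have "\<dots> = vs ! ((k + i) mod m)" using that by (simp add: nth_rotate m_def)
    finally show ?thesis .
  qed
  have c_nth: "c (vs ! i) = vs ! (Suc i mod m)" if "i < m" for i
    using pow[OF that, of 1] by simp
  have index: "\<exists>i<m. w = vs ! i" if "w \<in> verts C" for w
    using that unfolding vs(3) in_set_conv_nth m_def by blast
  show thesis
  proof (rule that)
    show "c permutes verts C" unfolding c_def vs(3) by (rule cycle_permutes)
    show "finite (verts C)" "verts C \<noteq> {}" using vs by auto
    show "sign c = (- 1) ^ (num_verts C - 1)"
      unfolding c_def sign_cycle_of_list[OF vs(1)] num_verts_def vs(3) distinct_card[OF vs(1)] ..
    show "edges C = {{w, c w} | w. w \<in> verts C}"
    proof (intro equalityI subsetI)
      fix e assume "e \<in> edges C"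
      then obtain i where i: "i < m" "e = {vs ! i, vs ! (Suc i mod m)}"
        unfolding vs(4) m_def by blast
      then have "e = {vs ! i, c (vs ! i)}" "vs ! i \<in> verts C"
        by (simp_all add: c_nth vs(3) m_def)
      then show "e \<in> {{w, c w} | w. w \<in> verts C}" by blast
    next
      fix e assume "e \<in> {{w, c w} | w. w \<in> verts C}"
      then obtain w where w: "e = {w, c w}" "w \<in> verts C" by blast
      then obtain i where i: "i < m" "w = vs ! i" using index by blast
      then have "e = {vs ! i, vs ! (Suc i mod m)}" using w(1) c_nth[OF i(1)] by (simp only:)
      then show "e \<in> edges C" unfolding vs(4) using i(1) m_def by blast
    qed
    show "\<forall>w\<in>verts C. c (c w) \<noteq> w"
    proof (rule ballI, rule notI)
      fix w assume w: "w \<in> verts C" and eq: "c (c w) = w"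
      obtain i where i: "i < m" "w = vs ! i" using index[OF w] by blast
      have "c (c w) = vs ! ((2 + i) mod m)"
        using pow[OF i(1), of 2] i(2) by (simp add: numeral_2_eq_2)
      then have "vs ! ((2 + i) mod m) = vs ! i" using eq i(2) by simp
      moreover have "(2 + i) mod m < m" using i(1) by simp
      ultimately have "(2 + i) mod m = i"
        using i(1) nth_eq_iff_index_eq[OF vs(1)] unfolding m_def by blast
      \<comment> \<open>With at least three vertices, 2 + i wraps around at most once, and neither 2
        nor 2 - m is 0.\<close>
      moreover have "(2 + i) mod m = (if 2 + i < m then 2 + i else 2 + i - m)"
        using i(1) vs(2) unfolding m_def[symmetric] by (simp add: mod_if)
      ultimately show False using vs(2) i(1) unfolding m_def[symmetric] by (simp split: if_splits)
    qed
    show "\<forall>u\<in>verts C. \<forall>w\<in>verts C. \<exists>k. w = (c ^^ k) u"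
    proof (intro ballI)
      fix u w assume uw: "u \<in> verts C" "w \<in> verts C"
      obtain i j where i: "i < m" "u = vs ! i" and j: "j < m" "w = vs ! j"
        using index[OF uw(1)] index[OF uw(2)] by blast
      \<comment> \<open>From position i, m - i steps lead round to position 0, and j more reach the
        target.\<close>
      have "(c ^^ (j + (m - i))) u = vs ! ((j + (m - i) + i) mod m)"
        unfolding i(2) by (rule pow[OF i(1)])
      also have "\<dots> = w" using i(1) j by simp
      finally show "\<exists>k. w = (c ^^ k) u" by (intro exI) (rule sym)
    qed
  qed
qed

text \<open>Each vertex goes to its successor or its predecessor. As
  \<open>p (p w) \<noteq> w\<close> forbids turning back, one forward step forces all following
  ones; if there is none, every step is backward.\<close>

lemma edge_perm_on_cycle_cases:
  assumes c: "c permutes W" and cc: "\<And>w. w \<in> W \<Longrightarrow> c (c w) \<noteq> w"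
    and trans: "\<forall>u\<in>W. \<forall>w\<in>W. \<exists>k. w = (c ^^ k) u"
    and p: "\<And>w. w \<in> W \<Longrightarrow> {w, p w} \<in> {{u, c u} | u. u \<in> W} \<and> p (p w) \<noteq> w"
  shows "(\<forall>w\<in>W. p w = c w) \<or> (\<forall>w\<in>W. p w = inv_into UNIV c w)"
proof -
  have p_cases: "p w = c w \<or> p w = inv_into UNIV c w" if w: "w \<in> W" for w
  proof -
    obtain u where "{w, p w} = {u, c u}" using p[OF w] by blast
    then have "p w = c w \<or> (w = c u \<and> p w = u)" by (auto simp: doubleton_eq_iff)
    then show ?thesis using permutes_inverses(2)[OF c] by auto
  qed
  show ?thesis
  proof (cases "\<exists>u\<in>W. p u = c u")
    case True
    then obtain u where u: "u \<in> W" "p u = c u" by blast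
    have pow: "p ((c ^^ k) u) = c ((c ^^ k) u) \<and> (c ^^ k) u \<in> W" for k
    proof (induction k)
      case (Suc k)
      let ?w = "(c ^^ k) u"
      have w: "?w \<in> W" "p ?w = c ?w" using Suc by auto
      have cw: "c ?w \<in> W" using w(1) permutes_in_image[OF c] by blast
      have "p (c ?w) \<noteq> inv_into UNIV c (c ?w)"
        using p[OF w(1)] unfolding w(2) permutes_inverses(2)[OF c] by blast
      then have "p (c ?w) = c (c ?w)" using p_cases[OF cw] by blast
      then show ?case using cw by simp
    qed (use u in simp)
    have "\<forall>w\<in>W. p w = c w"
    proof
      fix w assume w: "w \<in> W"
      obtain k where "w = (c ^^ k) u" using bspec[OF bspec[OF trans u(1)] w] by (rule exE)
      then show "p w = c w" using pow[of k] by (simp only:)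
    qed
    then show ?thesis ..
  next
    case False
    then have "\<forall>w\<in>W. p w = inv_into UNIV c w" using p_cases by blast
    then show ?thesis ..
  qed
qed

lemma simple_graph_delete_verts:
  assumes G: "simple_graph G"
  shows "simple_graph (delete_verts G S)"
  unfolding simple_graph_def
proof (intro conjI subsetI)
  show "finite (verts (delete_verts G S))"
    using simple_graphD(1)[OF G] by (simp add: delete_verts_def)
  fix e assume "e \<in> edges (delete_verts G S)"
  then have e: "e \<in> edges G" "e \<inter> S = {}" by (simp_all add: delete_verts_def)
  obtain u v where uv: "e = {u, v}" "u \<in> verts G" "v \<in> verts G" "u \<noteq> v"
    using simple_graphD(4)[OF G e(1)] by (elim exE conjE)
  moreover have "u \<notin> S" "v \<notin> S" using e(2) uv(1) by auto
  ultimately show "e \<in> {{u, v} | u v. u \<in> verts (delete_verts G S) \<and>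
      v \<in> verts (delete_verts G S) \<and> u \<noteq> v}"
    by (intro CollectI exI[of _ u] exI[of _ v] conjI) (simp_all add: delete_verts_def)
qed

lemma edge_perm_involution_if_acyclic:
  assumes "simple_graph G" "\<nexists>D. cycle_of D G"
  shows "edge_involutions G = edge_perms G"
  using cycle_of_edge_perm[OF assms(1)] assms(2) unfolding edge_involutions_def by blast

lemma graph_poly_acyclic:
  assumes "simple_graph G" "\<nexists>D. cycle_of D G"
  shows "graph_poly G = matching_poly G"
  unfolding graph_poly_eq_sum_edge_perms[OF assms(1)] edge_perm_involution_if_acyclic[OF assms, symmetric]
  by (rule sum_edge_involutions[OF assms(1)])

text \<open>A permutation along edges that is no involution rotates the unique cycle, in one of two
  directions, and is an involution on the other vertices. A rotation of an even cycle is an odd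
  permutation, while its factors -1 cancel; so the term is minus the one that the involution
  contributes for the graph without the cycle.\<close>

lemma graph_poly_unique_cycle:
  assumes G: "simple_graph G" and C: "cycle_of C G"
    and unique: "\<And>D. cycle_of D G \<Longrightarrow> D = C" and even: "even (num_verts C)"
  shows "graph_poly G = matching_poly G - 2 * matching_poly (delete_verts G (verts C))"
proof -
  define W where "W = verts C"
  define F where "F = delete_verts G W"
  have WG: "W \<subseteq> verts G" and CG: "edges C \<subseteq> edges G" and cyc: "cycle_graph C"
    using C by (auto simp: cycle_of_def subgraph_def W_def)
  have V: "finite (verts G)" by (rule simple_graphD(1)[OF G])
  have F: "simple_graph F" unfolding F_def by (rule simple_graph_delete_verts[OF G])
  have vF: "verts F = verts G - W" and eF: "edges F = {e \<in> edges G. e \<inter> W = {}}"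
    by (auto simp: F_def delete_verts_def)
  obtain c where c: "c permutes W" and W: "finite W" "W \<noteq> {}"
    and sgn: "sign c = (- 1) ^ (num_verts C - 1)"
    and eC: "edges C = {{w, c w} | w. w \<in> W}" and cc': "\<forall>w\<in>W. c (c w) \<noteq> w"
    and trans: "\<forall>u\<in>W. \<forall>w\<in>W. \<exists>k. w = (c ^^ k) u"
    by (rule cycle_graph_rotation[OF cyc, folded W_def])
  note cc = bspec[OF cc']
  have ic: "inv_into UNIV c permutes W" by (rule permutes_inv[OF c])
  define R where "R = {c, inv_into UNIV c}"
  \<comment> \<open>The number of vertices is even and positive, so the truncated exponent
    \<open>num_verts C - 1\<close> is odd.\<close>
  have sgn': "sign c = - 1"
    using even W unfolding sgn num_verts_def W_def[symmetric] by (simp add: card_gt_0_iff)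
  have rot: "r permutes W" "sign r = - 1" "\<And>w. w \<in> W \<Longrightarrow> {w, r w} \<in> edges C"
    "\<And>w. w \<in> W \<Longrightarrow> r (r w) \<noteq> w" if "r \<in> R" for r
  proof -
    have r: "r = c \<or> r = inv_into UNIV c" using that by (simp add: R_def)
    then show "r permutes W" using c ic by blast
    have "permutation c" using c W(1) by (auto simp: permutation_permutes)
    then show "sign r = - 1" using r sgn' sign_inverse[of c] by auto
    show "{w, r w} \<in> edges C" if w: "w \<in> W" for w
    proof -
      have "inv_into UNIV c w \<in> W" using w permutes_in_image[OF ic] by blast
      then have "{inv_into UNIV c w, c (inv_into UNIV c w)} \<in> edges C" unfolding eC by blast
      then have "{w, inv_into UNIV c w} \<in> edges C"
        unfolding permutes_inverses(1)[OF c] by (simp only: insert_commute)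
      moreover have "{w, c w} \<in> edges C" unfolding eC using w by blast
      ultimately show ?thesis using r by auto
    qed
    show "r (r w) \<noteq> w" if w: "w \<in> W" for w
    proof
      assume eq: "r (r w) = w"
      then have "inv_into UNIV c (inv_into UNIV c w) = w" using r cc[OF w] by auto
      then have "c (c w) = w" using permutes_inverses(1)[OF c] by metis
      then show False using cc[OF w] by simp
    qed
  qed
  \<comment> \<open>The two directions differ because \<open>c\<close> is no involution; this yields
    the factor 2.\<close>
  have "c \<noteq> inv_into UNIV c"
  proof
    assume eq: "c = inv_into UNIV c"
    obtain w where w: "w \<in> W" using W(2) by blast
    have "c (c w) = w" using permutes_inverses(2)[OF c, of w] eq by metis
    then show False using cc[OF w] by simp
  qed
  then have cardR: "card R = 2" by (simp add: R_def)
  define N where "N = edge_perms G - edge_involutions G"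
  have q_props: "q permutes verts F" "\<And>w. w \<in> W \<Longrightarrow> q w = w" "\<And>v. q (q v) = v"
    "\<And>v. v \<notin> W \<Longrightarrow> q v \<notin> W" "\<And>v. q v \<noteq> v \<Longrightarrow> {v, q v} \<in> edges F"
    if q: "q \<in> edge_involutions F" for q
  proof -
    show per: "q permutes verts F" and inv: "\<And>v. q (q v) = v"
      and "\<And>v. q v \<noteq> v \<Longrightarrow> {v, q v} \<in> edges F"
      using q by (auto simp: edge_involutions_def edge_perms_def)
    show fixed: "q w = w" if "w \<in> W" for w
      using permutes_not_in[OF per] that vF by blast
    show "q v \<notin> W" if "v \<notin> W" for v
      using fixed[of "q v"] inv[of v] that by auto
  qed
  have comp_in: "r \<circ> q \<in> N" and comp_weight: "perm_weight G (r \<circ> q) = - perm_weight F q"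
    if r: "r \<in> R" and q: "q \<in> edge_involutions F" for r q
  proof -
    note r' = rot[OF r] and q' = q_props[OF q]
    have rq: "(r \<circ> q) v = (if v \<in> W then r v else q v)" for v
      using q'(2,4) permutes_not_in[OF r'(1)] by auto
    have "q permutes verts G" by (rule permutes_subset[OF q'(1)]) (use vF in blast)
    then have "(r \<circ> q) permutes verts G"
      by (rule permutes_compose) (rule permutes_subset[OF r'(1) WG])
    moreover have "{v, (r \<circ> q) v} \<in> edges G" if "(r \<circ> q) v \<noteq> v" for v
      using that r'(3)[of v] q'(5)[of v] CG eF unfolding rq by (auto split: if_splits)
    ultimately have "r \<circ> q \<in> edge_perms G" by (simp add: edge_perms_def)
    moreover have "r \<circ> q \<notin> edge_involutions G"
    proof
      assume *: "r \<circ> q \<in> edge_involutions G"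
      obtain w where w: "w \<in> W" using W(2) by blast
      have "r w \<in> W" using w permutes_in_image[OF r'(1)] by blast
      moreover have "(r \<circ> q) ((r \<circ> q) w) = w" using * by (simp only: edge_involutions_def mem_Collect_eq)
      ultimately have "r (r w) = w" using w unfolding rq by simp
      then show False using r'(4)[OF w] by simp
    qed
    ultimately show "r \<circ> q \<in> N" by (simp add: N_def)
    have "r w \<noteq> w" if "w \<in> W" for w using r'(4)[OF that] by metis
    then have supp: "{v. (r \<circ> q) v \<noteq> v} = W \<union> {v. q v \<noteq> v}"
      unfolding rq using q'(2) by auto
    have suppq: "{v. q v \<noteq> v} \<subseteq> verts F" by (rule permutes_support[OF q'(1)])
    have fin: "finite {v. q v \<noteq> v}" by (rule finite_subset[OF suppq simple_graphD(1)[OF F]])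
    have card_supp: "card {v. (r \<circ> q) v \<noteq> v} = card W + card {v. q v \<noteq> v}"
      unfolding supp by (rule card_Un_disjoint[OF W(1) fin]) (use q'(2) in auto)
    have nF: "num_verts F = num_verts G - card W"
      unfolding num_verts_def vF by (rule card_Diff_subset[OF W(1) WG])
    have "permutation r" "permutation q"
      by (rule permutes_imp_permutation[OF W(1) r'(1)])
        (rule permutes_imp_permutation[OF simple_graphD(1)[OF F] q'(1)])
    then have "sign (r \<circ> q) = - sign q" by (simp add: sign_compose r'(2) del: comp_apply)
    moreover have "even (card W)" using even by (simp add: W_def num_verts_def)
    ultimately show "perm_weight G (r \<circ> q) = - perm_weight F q"
      unfolding perm_weight_def card_supp nF by (simp add: power_add)
  qed
  have decomp: "\<exists>r\<in>R. \<exists>q\<in>edge_involutions F. p = r \<circ> q" if p: "p \<in> N" for p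
  proof -
    have pe: "p \<in> edge_perms G" and "\<exists>v. p (p v) \<noteq> v"
      using p by (auto simp: N_def edge_involutions_def)
    then have per: "p permutes verts G" and edge: "\<And>v. p v \<noteq> v \<Longrightarrow> {v, p v} \<in> edges G"
      by (auto simp: edge_perms_def)
    \<comment> \<open>A vertex that does not return after two steps lies on a cycle, which is
      \<open>C\<close> by uniqueness. Hence all such vertices lie on \<open>C\<close>, and a single
      one makes \<open>p\<close> run around all of it.\<close>
    have in_W: "v \<in> W \<and> (\<forall>w\<in>W. p w \<in> W \<and> {w, p w} \<in> edges C \<and> p (p w) \<noteq> w)" if "p (p v) \<noteq> v" for v
    proof -
      obtain D where D: "cycle_of D G" "v \<in> verts D"
        "\<And>w. w \<in> verts D \<Longrightarrow> p w \<in> verts D \<and> {w, p w} \<in> edges D \<and> p (p w) \<noteq> w"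
        using cycle_of_edge_perm[OF G pe \<open>p (p v) \<noteq> v\<close>] by metis
      show ?thesis using D(2,3) unfolding unique[OF D(1)] W_def by blast
    qed
    then have onW: "p w \<in> W" "{w, p w} \<in> edges C" "p (p w) \<noteq> w" if "w \<in> W" for w
      using \<open>\<exists>v. p (p v) \<noteq> v\<close> that by blast+
    have "(\<forall>w\<in>W. p w = c w) \<or> (\<forall>w\<in>W. p w = inv_into UNIV c w)"
      using onW(2,3) by (intro edge_perm_on_cycle_cases[OF c cc trans]) (auto simp only: eC)
    then obtain r where r: "r \<in> R" and pr: "\<And>w. w \<in> W \<Longrightarrow> p w = r w"
      unfolding R_def by blast
    note r' = rot[OF r]
    \<comment> \<open>Undoing the rotation leaves the identity on the cycle and \<open>p\<close>
      elsewhere.\<close>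
    define q where "q = inv_into UNIV r \<circ> p"
    have p_eq: "p = r \<circ> q"
      unfolding q_def using permutes_inverses(1)[OF r'(1)] by (auto simp: fun_eq_iff)
    have qW: "q w = w" if "w \<in> W" for w
      unfolding q_def using pr[OF that] permutes_inverses(2)[OF r'(1)] by simp
    have pW: "p v \<notin> W" if v: "v \<notin> W" for v
    proof
      assume "p v \<in> W"
      then have "inv_into UNIV r (p v) \<in> W" using permutes_in_image[OF permutes_inv[OF r'(1)]] by blast
      then have "p (inv_into UNIV r (p v)) = p v"
        using pr permutes_inverses(1)[OF r'(1)] by metis
      then have "inv_into UNIV r (p v) = v" using permutes_inj[OF per] by (simp only: inj_eq)
      with \<open>inv_into UNIV r (p v) \<in> W\<close> v show False by simp
    qed
    have qnW: "q v = p v" if "v \<notin> W" for v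
      unfolding q_def using permutes_not_in[OF permutes_inv[OF r'(1)] pW[OF that]] by simp
    have "q permutes verts G"
      unfolding q_def by (rule permutes_compose[OF per])
        (rule permutes_subset[OF permutes_inv[OF r'(1)] WG])
    then have "q permutes verts F"
      by (rule permutes_superset) (use vF qW in auto)
    moreover have "{v, q v} \<in> edges F" if ne: "q v \<noteq> v" for v
    proof -
      have v: "v \<notin> W" using qW ne by blast
      show ?thesis using edge[of v] ne pW[OF v] v unfolding qnW[OF v] eF by simp
    qed
    moreover have "q (q v) = v" for v
    proof (cases "v \<in> W")
      case False
      then have "p (p v) = v" using in_W by blast
      then show ?thesis using qnW[OF False] qnW[OF pW[OF False]] by simp
    qed (simp add: qW)
    ultimately have "q \<in> edge_involutions F" by (simp add: edge_involutions_def edge_perms_def)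
    then show ?thesis using r p_eq by blast
  qed
  have inj: "inj_on (\<lambda>(r, q). r \<circ> q) (R \<times> edge_involutions F)"
  proof (rule inj_onI, clarify)
    fix r q r' q' assume r: "r \<in> R" "r' \<in> R"
      and q: "q \<in> edge_involutions F" "q' \<in> edge_involutions F" and eq: "r \<circ> q = r' \<circ> q'"
    have "r v = r' v" for v
    proof (cases "v \<in> W")
      case True
      then show ?thesis
        using fun_cong[OF eq, of v] q_props(2)[OF q(1) True] q_props(2)[OF q(2) True] by simp
    next
      case False
      then show ?thesis
        using permutes_not_in[OF rot(1)[OF r(1)]] permutes_not_in[OF rot(1)[OF r(2)]] by simp
    qed
    then have rr: "r = r'" by blast
    have "q v = q' v" for v
      using fun_cong[OF eq, of v] permutes_inj[OF rot(1)[OF r(2)]]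
      unfolding rr comp_def by (simp only: inj_eq)
    then show "r = r' \<and> q = q'" using rr by blast
  qed
  have image: "(\<lambda>(r, q). r \<circ> q) ` (R \<times> edge_involutions F) = N"
  proof (intro equalityI subsetI)
    fix p assume "p \<in> N"
    then obtain r q where "r \<in> R" "q \<in> edge_involutions F" "p = r \<circ> q" using decomp by blast
    then show "p \<in> (\<lambda>(r, q). r \<circ> q) ` (R \<times> edge_involutions F)" by blast
  qed (use comp_in in auto)
  have "(\<Sum>p\<in>N. perm_weight G p) =
      (\<Sum>x\<in>R \<times> edge_involutions F. perm_weight G ((\<lambda>(r, q). r \<circ> q) x))"
    by (rule sum.reindex_bij_betw[OF bij_betw_imageI[OF inj image], symmetric])
  also have "\<dots> = (\<Sum>x\<in>R \<times> edge_involutions F. - perm_weight F (snd x))"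
    by (rule sum.cong[OF refl]) (use comp_weight in auto)
  also have "\<dots> = (\<Sum>r\<in>R. \<Sum>q\<in>edge_involutions F. - perm_weight F q)"
    unfolding sum.cartesian_product case_prod_unfold ..
  also have "\<dots> = - 2 * matching_poly F"
    by (simp add: sum_negf cardR sum_edge_involutions[OF F])
  finally have N: "(\<Sum>p\<in>N. perm_weight G p) = - 2 * matching_poly F" .
  have "(\<Sum>p\<in>edge_perms G. perm_weight G p) =
      (\<Sum>p\<in>N. perm_weight G p) + (\<Sum>p\<in>edge_involutions G. perm_weight G p)"
    unfolding N_def by (rule sum.subset_diff)
      (use finite_edge_perms[OF V] in \<open>auto simp: edge_involutions_def\<close>)
  then show ?thesis
    unfolding graph_poly_eq_sum_edge_perms[OF G] N sum_edge_involutions[OF G] F_def W_def by simp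
qed

section \<open>Counting small matchings\<close>

lemma card_matching_le:
  assumes G: "simple_graph G" and M: "M \<in> matchings G"
  shows "2 * card M \<le> num_verts G"
proof -
  have "mate M \<in> edge_involutions G"
    using bij_betw_mate[OF G] M by (rule bij_betwE[rule_format])
  then have "mate M permutes verts G"
    by (simp add: edge_involutions_def edge_perms_def)
  then have "{v. mate M v \<noteq> v} \<subseteq> verts G" by (rule permutes_support)
  then show ?thesis
    unfolding card_mate_support[OF assms, symmetric] num_verts_def
    by (rule card_mono[OF simple_graphD(1)[OF G]])
qed

lemma num_matchings_of_nat: "num_matchings G (int k) = card {M \<in> matchings G. card M = k}"
  by (simp add: num_matchings_def matchings_def conj_assoc)

lemma num_matchings_neg: "j < 0 \<Longrightarrow> num_matchings G j = 0"
  by (auto simp: num_matchings_def card_eq_0_iff)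

lemma diff_double_eq_iff:
  fixes n m i :: nat
  assumes "2 * m \<le> n"
  shows "n - 2 * m = i \<longleftrightarrow> i \<le> n \<and> even (n - i) \<and> m = (n - i) div 2"
proof
  assume "n - 2 * m = i"
  then have "i \<le> n" "n - i = 2 * m" using assms by linarith+
  then show "i \<le> n \<and> even (n - i) \<and> m = (n - i) div 2" by simp
next
  assume *: "i \<le> n \<and> even (n - i) \<and> m = (n - i) div 2"
  then have "2 * ((n - i) div 2) = n - i" by (intro dvd_mult_div_cancel) blast
  then show "n - 2 * m = i" using * by linarith
qed

lemma coeff_matching_poly:
  assumes G: "simple_graph G"
  shows "coeff (matching_poly G) i =
    (if i \<le> num_verts G \<and> even (num_verts G - i)
     then (- 1) ^ ((num_verts G - i) div 2) * of_nat (num_matchings G (int ((num_verts G - i) div 2)))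
     else 0)"
proof -
  let ?n = "num_verts G" and ?k = "(num_verts G - i) div 2"
  have monom: "(- 1) ^ k * monom 1 m = (monom ((- 1) ^ k) m :: rat poly)" for k m
    by (cases "even k") (simp_all add: minus_monom)
  have "coeff (matching_poly G) i =
      (\<Sum>M\<in>matchings G. if ?n - 2 * card M = i then (- 1) ^ card M else 0)"
    by (simp add: matching_poly_def coeff_sum monom)
  also have "\<dots> = (\<Sum>M\<in>matchings G.
      if i \<le> ?n \<and> even (?n - i) \<and> card M = ?k then (- 1) ^ ?k else 0)"
  proof (rule sum.cong[OF refl])
    fix M assume "M \<in> matchings G"
    then have "2 * card M \<le> ?n" by (rule card_matching_le[OF G])
    then have iff: "?n - 2 * card M = i \<longleftrightarrow> i \<le> ?n \<and> even (?n - i) \<and> card M = ?k"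
      by (rule diff_double_eq_iff)
    show "(if ?n - 2 * card M = i then (- 1) ^ card M else 0) =
        (if i \<le> ?n \<and> even (?n - i) \<and> card M = ?k then (- 1) ^ ?k else (0 :: rat))"
      unfolding iff by (rule if_cong[OF refl _ refl]) (elim conjE, simp only:)
  qed
  also have "\<dots> = (if i \<le> ?n \<and> even (?n - i)
      then (\<Sum>M\<in>matchings G. if card M = ?k then (- 1) ^ ?k else 0) else 0)"
  proof (cases "i \<le> ?n \<and> even (?n - i)")
    case True
    then show ?thesis by (simp only: simp_thms if_True)
  next
    case False
    then have "\<not> (i \<le> ?n \<and> even (?n - i) \<and> card M = ?k)" for M :: "'a set set" by blast
    then show ?thesis by (simp only: False if_False sum.neutral_const)
  qed
  also have "(\<Sum>M\<in>matchings G. if card M = ?k then (- 1) ^ ?k else 0) =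
      (\<Sum>M\<in>{M \<in> matchings G. card M = ?k}. (- 1) ^ ?k :: rat)"
    by (rule sum.inter_filter[OF finite_matchings[OF G], symmetric])
  also have "\<dots> = (- 1) ^ ?k * of_nat (num_matchings G (int ?k))"
    by (simp add: num_matchings_of_nat)
  finally show ?thesis .
qed

section \<open>Double counting of edges and of pairs of edges\<close>

lemma card_filter_eq_sum:
  "finite A \<Longrightarrow> card {x \<in> A. P x} = (\<Sum>x\<in>A. if P x then 1 else 0)"
  by (simp add: sum.If_cases Int_def)

lemma card_incident_edges:
  assumes G: "simple_graph G"
  shows "card {e \<in> edges G. v \<in> e} = vdeg G v"
proof -
  have "inj_on (\<lambda>u. {v, u}) (nbs G v)"
    by (auto simp: inj_on_def doubleton_eq_iff)
  moreover have "(\<lambda>u. {v, u}) ` nbs G v = {e \<in> edges G. v \<in> e}"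
  proof (intro equalityI subsetI)
    fix e assume e: "e \<in> {e \<in> edges G. v \<in> e}"
    then obtain a b where ab: "e = {a, b}" "a \<in> verts G" "b \<in> verts G"
      using simple_graphD(4)[OF G, of e] by auto
    have "v = a \<or> v = b" using e ab(1) by auto
    then show "e \<in> (\<lambda>u. {v, u}) ` nbs G v"
    proof
      assume "v = a"
      then have "e = {v, b}" "b \<in> nbs G v" using ab e by (simp_all add: nbs_def)
      then show ?thesis by (rule image_eqI)
    next
      assume "v = b"
      then have "e = {v, a}" "a \<in> nbs G v" using ab e by (simp_all add: nbs_def insert_commute)
      then show ?thesis by (rule image_eqI)
    qed
  qed (auto simp: nbs_def)
  ultimately show ?thesis using card_image by fastforce
qed

lemma card_edge: "simple_graph G \<Longrightarrow> e \<in> edges G \<Longrightarrow> card e = 2 \<and> finite e \<and> e \<subseteq> verts G"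
  using simple_graphD(4)[of G e] by auto

lemma sum_vdeg:
  assumes G: "simple_graph G"
  shows "(\<Sum>v\<in>verts G. vdeg G v) = 2 * card (edges G)"
proof -
  have "(\<Sum>v\<in>verts G. vdeg G v) = (\<Sum>v\<in>verts G. \<Sum>e\<in>edges G. if v \<in> e then 1 else 0)"
    by (simp only: card_incident_edges[OF G, symmetric] card_filter_eq_sum[OF simple_graphD(5)[OF G]])
  also have "\<dots> = (\<Sum>e\<in>edges G. \<Sum>v\<in>verts G. if v \<in> e then 1 else 0)"
    by (rule sum.swap)
  also have "\<dots> = (\<Sum>e\<in>edges G. card {v \<in> verts G. v \<in> e})"
    by (simp only: card_filter_eq_sum[OF simple_graphD(1)[OF G]])
  also have "\<dots> = (\<Sum>e\<in>edges G. 2)"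
  proof (rule sum.cong[OF refl])
    fix e assume "e \<in> edges G"
    then have "{v \<in> verts G. v \<in> e} = e" "card e = 2" using card_edge[OF G] by auto
    then show "card {v \<in> verts G. v \<in> e} = 2" by simp
  qed
  finally show ?thesis by simp
qed

text \<open>Both sides count the triples (v, e, f) of a vertex v and edges e and f containing
  it.\<close>

lemma sum_card_inter_edges:
  assumes G: "simple_graph G"
  shows "(\<Sum>e\<in>edges G. \<Sum>f\<in>edges G. card (e \<inter> f)) = (\<Sum>v\<in>verts G. vdeg G v ^ 2)"
proof -
  let ?V = "verts G" and ?E = "edges G"
  let ?i = "\<lambda>v e. if v \<in> e then 1 else 0 :: nat"
  have "(\<Sum>e\<in>?E. \<Sum>f\<in>?E. card (e \<inter> f)) = (\<Sum>e\<in>?E. \<Sum>f\<in>?E. \<Sum>v\<in>?V. ?i v e * ?i v f)"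
  proof (intro sum.cong refl)
    fix e f assume e: "e \<in> ?E"
    have "e \<inter> f = {v \<in> ?V. v \<in> e \<and> v \<in> f}"
      using card_edge[OF G e] by blast
    then have "card (e \<inter> f) = (\<Sum>v\<in>?V. if v \<in> e \<and> v \<in> f then 1 else 0)"
      by (simp only: card_filter_eq_sum[OF simple_graphD(1)[OF G]])
    also have "\<dots> = (\<Sum>v\<in>?V. ?i v e * ?i v f)"
      by (rule sum.cong) simp_all
    finally show "card (e \<inter> f) = (\<Sum>v\<in>?V. ?i v e * ?i v f)" .
  qed
  also have "\<dots> = (\<Sum>v\<in>?V. \<Sum>e\<in>?E. \<Sum>f\<in>?E. ?i v e * ?i v f)"
    by (subst sum.swap[of _ ?V], subst sum.swap[of _ ?V]) (rule refl)
  also have "\<dots> = (\<Sum>v\<in>?V. (\<Sum>e\<in>?E. ?i v e) * (\<Sum>f\<in>?E. ?i v f))"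
    by (simp only: sum_product)
  also have "\<dots> = (\<Sum>v\<in>?V. vdeg G v ^ 2)"
  proof (rule sum.cong[OF refl])
    fix v
    have "(\<Sum>e\<in>?E. ?i v e) = vdeg G v"
      by (simp only: card_incident_edges[OF G, symmetric] card_filter_eq_sum[OF simple_graphD(5)[OF G]])
    then show "(\<Sum>e\<in>?E. ?i v e) * (\<Sum>f\<in>?E. ?i v f) = vdeg G v ^ 2"
      by (simp add: power2_eq_square)
  qed
  finally show ?thesis .
qed

lemma num_matchings_0:
  assumes "simple_graph G"
  shows "num_matchings G 0 = 1"
proof -
  have "{M \<in> matchings G. card M = 0} = {{}}"
    using finite_subset[OF _ simple_graphD(5)[OF assms]] by (auto simp: matchings_def)
  then show ?thesis using num_matchings_of_nat[of G 0] by simp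
qed

lemma num_matchings_1: "num_matchings G 1 = card (edges G)"
proof -
  have "{M \<in> matchings G. card M = 1} = (\<lambda>e. {e}) ` edges G"
    by (auto simp: matchings_def card_1_singleton_iff)
  then show ?thesis
    using num_matchings_of_nat[of G 1] by (simp add: card_image)
qed

text \<open>Ordered pairs of edges are counted: disjoint ones give twice the 2-matchings, and the
  numbers of common vertices add up to the sum of the squared degrees. Equal edges meet in two
  vertices, which accounts for the extra \<open>card (edges G)\<close>.\<close>

lemma num_matchings_2:
  assumes G: "simple_graph G"
  shows "2 * num_matchings G 2 + (\<Sum>v\<in>verts G. vdeg G v ^ 2) = card (edges G) ^ 2 + card (edges G)"
proof -
  let ?E = "edges G"
  let ?D = "{x \<in> ?E \<times> ?E. fst x \<inter> snd x = {}}" and ?g = "\<lambda>x. {fst x, snd x}"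
  let ?T = "{M \<in> matchings G. card M = 2}"
  have E: "finite ?E" by (rule simple_graphD(5)[OF G])
  have D: "finite ?D" using E by simp
  have ne: "e \<noteq> f" if "e \<in> ?E" "e \<inter> f = {}" for e f
    using that card_edge[OF G, of e] by auto
  have img: "?g ` ?D \<subseteq> ?T"
  proof (rule image_subsetI)
    fix x assume "x \<in> ?D"
    then have x: "fst x \<in> ?E" "snd x \<in> ?E" "fst x \<inter> snd x = {}" by auto
    have "disjoint {fst x, snd x}" by (rule disjointI) (use x(3) in auto)
    then show "?g x \<in> ?T" using x ne[OF x(1,3)] by (simp add: matchings_def)
  qed
  \<comment> \<open>A 2-matching arises from its two orderings.\<close>
  have fibre: "card {x. x \<in> ?D \<and> ?g x = M} = 2" if M: "M \<in> ?T" for M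
  proof -
    obtain e f where ef: "M = {e, f}" "e \<noteq> f" using M by (auto simp: card_2_iff)
    have E: "e \<in> ?E" "f \<in> ?E" "disjoint M" using M ef by (auto simp: matchings_def)
    have disj: "e \<inter> f = {}" "f \<inter> e = {}"
      using disjointD[OF E(3), of e f] ef by (simp_all add: Int_commute)
    have "{x. x \<in> ?D \<and> ?g x = M} = {(e, f), (f, e)}"
    proof (intro equalityI subsetI)
      fix x assume "x \<in> {x. x \<in> ?D \<and> ?g x = M}"
      then have "{fst x, snd x} = {e, f}" using ef(1) by simp
      then have "fst x = e \<and> snd x = f \<or> fst x = f \<and> snd x = e"
        unfolding doubleton_eq_iff .
      then show "x \<in> {(e, f), (f, e)}" by (auto simp: prod_eq_iff)
    next
      fix x assume "x \<in> {(e, f), (f, e)}"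
      then consider "x = (e, f)" | "x = (f, e)" by blast
      then show "x \<in> {x. x \<in> ?D \<and> ?g x = M}"
        using E(1,2) disj ef(1) by cases (simp_all add: insert_commute)
    qed
    then show ?thesis using ef(2) by simp
  qed
  have "card ?D = (\<Sum>M\<in>?T. card {x. x \<in> ?D \<and> ?g x = M})"
    using sum.group[OF D _ img, of "\<lambda>_. 1 :: nat"] finite_matchings[OF G] by simp
  also have "\<dots> = 2 * num_matchings G 2"
    using fibre num_matchings_of_nat[of G 2] by simp
  finally have cD: "card ?D = 2 * num_matchings G 2" .
  \<comment> \<open>Distinct edges of a simple graph share at most one vertex, so the excess over 1
    comes from equal edges only.\<close>
  have int: "card (e \<inter> f) + (if e \<inter> f = {} then 1 else 0) = 1 + (if f = e then 1 else 0)"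
    if e: "e \<in> ?E" and f: "f \<in> ?E" for e f
  proof (cases "f = e")
    case True
    then show ?thesis using card_edge[OF G e] by auto
  next
    case False
    have "card (e \<inter> f) < 2"
    proof (rule ccontr)
      assume "\<not> ?thesis"
      then have "e \<inter> f = e" "e \<inter> f = f"
        using card_edge[OF G e] card_edge[OF G f]
        by (intro card_seteq; simp)+
      then show False using False by simp
    qed
    moreover have "card (e \<inter> f) = 0 \<longleftrightarrow> e \<inter> f = {}"
      using card_edge[OF G e] by (simp add: card_eq_0_iff)
    ultimately show ?thesis using False by (simp split: if_split) linarith
  qed
  have "(\<Sum>e\<in>?E. \<Sum>f\<in>?E. card (e \<inter> f)) + (\<Sum>e\<in>?E. \<Sum>f\<in>?E. if e \<inter> f = {} then 1 else 0) =
      (\<Sum>e\<in>?E. \<Sum>f\<in>?E. 1 + (if f = e then 1 else 0))"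
    unfolding sum.distrib[symmetric] by (intro sum.cong refl int)
  also have "\<dots> = (\<Sum>e\<in>?E. card ?E + 1)"
    by (rule sum.cong[OF refl], subst sum.distrib) (simp add: E)
  also have "\<dots> = card ?E ^ 2 + card ?E"
    by (simp add: power2_eq_square)
  also have "(\<Sum>e\<in>?E. \<Sum>f\<in>?E. if e \<inter> f = {} then 1 else 0) = card ?D"
  proof -
    have "card ?D = (\<Sum>x\<in>?E \<times> ?E. if fst x \<inter> snd x = {} then 1 else 0)"
      using E by (intro card_filter_eq_sum) simp
    then show ?thesis by (simp only: sum.cartesian_product case_prod_unfold)
  qed
  finally show ?thesis
    unfolding cD sum_card_inter_edges[OF G] by simp
qed

section \<open>The denominator of the coronal\<close>

text \<open>Clearing denominators gives \<open>N * (f * g) = (A * g + B * f) * ?\<phi>\<close>. The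
  prime \<open>f\<close> divides neither \<open>A\<close>, for reasons of degree, nor
  \<open>g\<close>, so it divides the characteristic polynomial; likewise \<open>g\<close>, which is
  coprime to \<open>f\<close>.\<close>

lemma coronal_denominator_dvd:
  fixes f g A B :: "rat poly"
  assumes V: "finite (verts G)"
    and irr: "irreducible f" "irreducible g" and monic: "lead_coeff f = 1" "lead_coeff g = 1"
    and "f \<noteq> g" and deg: "degree A < degree f" "degree B < degree g" and nz: "A \<noteq> 0" "B \<noteq> 0"
    and coronal: "coronal G = to_fract A / to_fract f + to_fract B / to_fract g"
  shows "f * g dvd graph_poly G"
proof -
  let ?\<phi> = "graph_poly G :: rat poly"
  obtain N where N: "coronal G = to_fract N / to_fract ?\<phi>"
    using coronal_expansion[OF V] by metis
  have nz': "f \<noteq> 0" "g \<noteq> 0" using irr by auto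
  have "to_fract N / to_fract ?\<phi> = to_fract (A * g + B * f) / to_fract (f * g)"
    unfolding N[symmetric] coronal using nz' by (simp add: add_frac_eq)
  then have "to_fract N * to_fract (f * g) = to_fract (A * g + B * f) * to_fract ?\<phi>"
    using nz' graph_poly_nonzero[of G, where ?'b = rat] by (subst (asm) frac_eq_eq) simp_all
  then have eq: "N * (f * g) = (A * g + B * f) * ?\<phi>"
    by (simp only: to_fract_mult[symmetric] to_fract_eq_iff)
  \<comment> \<open>The generic pair allows a second use with the roles of \<open>f\<close> and
    \<open>g\<close> exchanged.\<close>
  have dvd: "p dvd ?\<phi>" and cop: "coprime p q"
    if p: "irreducible p" "lead_coeff p = 1" and q: "irreducible q" "lead_coeff q = 1"
      and "p \<noteq> q" "degree a < degree p" "a \<noteq> 0"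
      and eq: "N * (p * q) = (a * q + b * p) * ?\<phi>" for p q a b
  proof -
    have prime: "prime_elem p" using p(1) by (rule field_poly_irreducible_imp_prime)
    have npq: "\<not> p dvd q"
    proof
      assume pq: "p dvd q"
      have "\<not> is_unit p" using p(1) by (rule irreducible_not_unit)
      then have "q dvd p" using irreducibleD'[OF q(1) pq] by blast
      then have "p = q" using p(2) q(2) pq by (intro poly_dvd_antisym) auto
      with \<open>p \<noteq> q\<close> show False ..
    qed
    then show "coprime p q" by (rule prime_elem_imp_coprime[OF prime])
    have "\<not> p dvd a" using that(6,7) by (auto dest: dvd_imp_degree_le)
    with npq have "\<not> p dvd a * q + b * p"
      by (simp add: dvd_add_left_iff prime_elem_dvd_mult_iff[OF prime])
    moreover have "p dvd (a * q + b * p) * ?\<phi>" unfolding eq[symmetric] by simp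
    ultimately show "p dvd ?\<phi>" by (simp only: prime_elem_dvd_mult_iff[OF prime]) simp
  qed
  have "f dvd ?\<phi>" "coprime f g"
    using dvd[OF irr(1) monic(1) irr(2) monic(2) \<open>f \<noteq> g\<close> deg(1) nz(1) eq]
      cop[OF irr(1) monic(1) irr(2) monic(2) \<open>f \<noteq> g\<close> deg(1) nz(1) eq] .
  moreover have "g dvd ?\<phi>"
    using dvd[OF irr(2) monic(2) irr(1) monic(1) \<open>f \<noteq> g\<close>[symmetric] deg(2) nz(2), of A] eq
    by (simp only: mult.commute add.commute)
  ultimately show ?thesis by (intro divides_mult)
qed

section \<open>Disjoint unions\<close>

text \<open>The summands of a disjoint union have other vertex types than the union, so their cycles
  are compared through embeddings.\<close>

definition map_graph :: "('a \<Rightarrow> 'b) \<Rightarrow> 'a sgraph \<Rightarrow> 'b sgraph" where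
  "map_graph f G = \<lparr>verts = f ` verts G, edges = (`) f ` edges G\<rparr>"

lemma verts_map_graph [simp]: "verts (map_graph f G) = f ` verts G"
  and edges_map_graph [simp]: "edges (map_graph f G) = (`) f ` edges G"
  by (simp_all add: map_graph_def)

lemma image_setcompr_less: "h ` {g i | i. i < m} = {h (g i) | i. i < (m :: nat)}"
  by blast

lemma cycle_graph_map_graph:
  assumes "cycle_graph C" "inj f"
  shows "cycle_graph (map_graph f C)"
proof -
  obtain vs where vs: "distinct vs" "3 \<le> length vs" "verts C = set vs"
    "edges C = {{vs ! i, vs ! (Suc i mod length vs)} | i. i < length vs}"
    using assms(1) unfolding cycle_graph_def by (elim exE conjE)
  have mod: "Suc i mod length vs < length vs" for i using vs(2) by (intro mod_less_divisor) linarith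
  have "(`) f ` edges C = {{f (vs ! i), f (vs ! (Suc i mod length vs))} | i. i < length vs}"
    unfolding vs(4) image_setcompr_less by (simp only: image_insert image_empty)
  also have "\<dots> = {{map f vs ! i, map f vs ! (Suc i mod length (map f vs))} | i. i < length (map f vs)}"
    by (intro Collect_cong ex_cong1) (use mod in auto)
  finally have edges: "edges (map_graph f C) =
      {{map f vs ! i, map f vs ! (Suc i mod length (map f vs))} | i. i < length (map f vs)}"
    by (simp only: edges_map_graph)
  have "distinct (map f vs)" using vs(1) inj_on_subset[OF assms(2) subset_UNIV] by (simp add: distinct_map)
  moreover have "3 \<le> length (map f vs)" "verts (map_graph f C) = set (map f vs)"
    using vs(2,3) by simp_all
  ultimately show ?thesis
    unfolding cycle_graph_def using edges by (intro exI[of _ "map f vs"] conjI)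
qed

text \<open>The assumption on edges says that \<open>f\<close> embeds \<open>X\<close> as a union of connected components of \<open>G\<close>.\<close>

lemma cycle_in_component:
  assumes X: "simple_graph X" and f: "inj f"
    and edge_iff: "\<And>v x. {f v, x} \<in> edges G \<longleftrightarrow> (\<exists>u. x = f u \<and> {v, u} \<in> edges X)"
    and vs: "distinct vs" "3 \<le> length vs" "verts D = set vs"
      "edges D = {{vs ! i, vs ! (Suc i mod length vs)} | i. i < length vs}"
    and D: "edges D \<subseteq> edges G" and start: "vs ! 0 = f a"
  shows "\<exists>D'. cycle_of D' X \<and> D = map_graph f D'"
proof -
  let ?m = "length vs"
  have m: "0 < ?m" using vs(2) by linarith
  have step: "{vs ! i, vs ! (Suc i mod ?m)} \<in> edges G" if "i < ?m" for i
    using D that unfolding vs(4) by blast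
  \<comment> \<open>Walking along the cycle, an edge that starts in the image of \<open>f\<close>
    also ends there.\<close>
  have "\<exists>u. vs ! i = f u" if "i < ?m" for i
    using that
  proof (induction i)
    case 0
    then show ?case using start by blast
  next
    case (Suc i)
    then obtain u where "vs ! i = f u" by auto
    then have "{f u, vs ! Suc i} \<in> edges G" using step[of i] Suc.prems by simp
    then show ?case unfolding edge_iff by blast
  qed
  then obtain w where w: "\<And>i. i < ?m \<Longrightarrow> vs ! i = f (w i)" by metis
  define ws where "ws = map w [0..<?m]"
  have len: "length ws = ?m" and ws_nth: "\<And>i. i < ?m \<Longrightarrow> ws ! i = w i" by (simp_all add: ws_def)
  have vs_ws: "vs = map f ws" by (rule nth_equalityI) (simp_all add: len ws_nth w)
  have mod: "Suc i mod ?m < ?m" for i using m by simp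
  have edge: "{ws ! i, ws ! (Suc i mod ?m)} \<in> edges X" if i: "i < ?m" for i
  proof -
    have "{f (ws ! i), f (ws ! (Suc i mod ?m))} \<in> edges G"
      using step[OF i] w[OF i] w[OF mod] ws_nth[OF i] ws_nth[OF mod] by (simp only:)
    then obtain u where "f (ws ! (Suc i mod ?m)) = f u" "{ws ! i, u} \<in> edges X"
      unfolding edge_iff by (elim exE conjE)
    then show ?thesis using f by (simp only: inj_eq)
  qed
  define D' where "D' = \<lparr>verts = set ws, edges = {{ws ! i, ws ! (Suc i mod length ws)} | i. i < length ws}\<rparr>"
  have "distinct ws" using vs(1) unfolding vs_ws by (simp add: distinct_map)
  then have cyc: "cycle_graph D'"
    unfolding cycle_graph_def using vs(2) len by (intro exI[of _ ws]) (simp add: D'_def)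
  have "u \<in> verts X" if "u \<in> set ws" for u
  proof -
    obtain i where "i < ?m" "u = ws ! i" using \<open>u \<in> set ws\<close> unfolding in_set_conv_nth len by blast
    then show ?thesis using simple_graphD(3)[OF X edge[of i]] by simp
  qed
  then have "verts D' \<subseteq> verts X" by (auto simp: D'_def)
  moreover have "edges D' \<subseteq> edges X" using edge by (auto simp: D'_def len)
  ultimately have "cycle_of D' X" using cyc by (simp add: cycle_of_def subgraph_def)
  moreover have "D = map_graph f D'"
  proof (rule sgraph.equality)
    show "verts D = verts (map_graph f D')" by (simp add: vs(3) vs_ws D'_def)
    have "vs ! i = f (ws ! i)" if "i < ?m" for i using that w ws_nth by simp
    then have "edges D = {f ` {ws ! i, ws ! (Suc i mod ?m)} | i. i < ?m}"
      unfolding vs(4) using mod by (metis (no_types, lifting) image_empty image_insert)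
    then show "edges D = edges (map_graph f D')"
      by (simp only: edges_map_graph D'_def len sgraph.select_convs image_setcompr_less)
  qed simp
  ultimately show ?thesis by blast
qed

lemma cycle_of_disjoint_union:
  assumes R: "simple_graph R" and U: "simple_graph U" and D: "cycle_of D (disjoint_union R U)"
  shows "(\<exists>D'. cycle_of D' R \<and> D = map_graph Inl D') \<or> (\<exists>D'. cycle_of D' U \<and> D = map_graph Inr D')"
proof -
  have "cycle_graph D" and sub: "edges D \<subseteq> edges (disjoint_union R U)"
    using D by (auto simp: cycle_of_def subgraph_def)
  then obtain vs where vs: "distinct vs" "3 \<le> length vs" "verts D = set vs"
    "edges D = {{vs ! i, vs ! (Suc i mod length vs)} | i. i < length vs}"
    unfolding cycle_graph_def by (elim exE conjE)
  show ?thesis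
  proof (cases "vs ! 0")
    case (Inl a)
    show ?thesis
      using cycle_in_component[OF R inj_Inl edges_disjoint_union_iff(1) vs sub Inl] ..
  next
    case (Inr b)
    show ?thesis
      using cycle_in_component[OF U inj_Inr edges_disjoint_union_iff(2) vs sub Inr] ..
  qed
qed

lemma simple_graph_disjoint_union:
  assumes R: "simple_graph R" and U: "simple_graph U"
  shows "simple_graph (disjoint_union R U)"
  unfolding simple_graph_def
proof (intro conjI subsetI)
  show "finite (verts (disjoint_union R U))"
    using simple_graphD(1)[OF R] simple_graphD(1)[OF U] by (simp add: verts_disjoint_union)
  let ?P = "{{u, v} | u v. u \<in> verts (disjoint_union R U) \<and> v \<in> verts (disjoint_union R U) \<and> u \<noteq> v}"
  fix e assume "e \<in> edges (disjoint_union R U)"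
  then consider e' where "e' \<in> edges R" "e = Inl ` e'" | e' where "e' \<in> edges U" "e = Inr ` e'"
    by (auto simp: disjoint_union_def)
  then show "e \<in> ?P"
  proof cases
    case (1 e')
    obtain u v where "e' = {u, v}" "u \<in> verts R" "v \<in> verts R" "u \<noteq> v"
      using simple_graphD(4)[OF R 1(1)] by (elim exE conjE)
    then show ?thesis unfolding 1(2)
      by (intro CollectI exI[of _ "Inl u"] exI[of _ "Inl v"]) (simp add: verts_disjoint_union)
  next
    case (2 e')
    obtain u v where "e' = {u, v}" "u \<in> verts U" "v \<in> verts U" "u \<noteq> v"
      using simple_graphD(4)[OF U 2(1)] by (elim exE conjE)
    then show ?thesis unfolding 2(2)
      by (intro CollectI exI[of _ "Inr u"] exI[of _ "Inr v"]) (simp add: verts_disjoint_union)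
  qed
qed

lemma cycle_of_map_graph_Inr:
  assumes "cycle_of C U"
  shows "cycle_of (map_graph Inr C) (disjoint_union R U)"
  using assms cycle_graph_map_graph[OF _ inj_Inr]
  by (auto simp: cycle_of_def subgraph_def disjoint_union_def)

lemma delete_verts_disjoint_union:
  "delete_verts (disjoint_union R U) (Inr ` S) = disjoint_union R (delete_verts U S)"
proof (rule sgraph.equality)
  show "verts (delete_verts (disjoint_union R U) (Inr ` S)) =
      verts (disjoint_union R (delete_verts U S))"
    by (auto simp: delete_verts_def disjoint_union_def)
  have "Inr ` e \<inter> Inr ` S = {} \<longleftrightarrow> e \<inter> S = {}" for e :: "'b set"
    by (simp only: image_Int[OF inj_Inr, symmetric] image_is_empty)
  moreover have "Inl ` e \<inter> Inr ` S = {}" for e :: "'a set" by auto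
  ultimately show "edges (delete_verts (disjoint_union R U) (Inr ` S)) =
      edges (disjoint_union R (delete_verts U S))"
    unfolding delete_verts_def disjoint_union_def by auto
qed simp

text \<open>\<open>R\<close> has no cycle, so the copy of \<open>C\<close> is the only cycle of the
  union.\<close>

lemma graph_poly_disjoint_union_unicyclic:
  assumes R: "tree R" and U: "unicyclic U" and C: "cycle_of C U" and even: "even (num_verts C)"
  shows "graph_poly (disjoint_union R U) = matching_poly (disjoint_union R U) -
    2 * matching_poly (disjoint_union R (delete_verts U (verts C)))"
proof -
  have sR: "simple_graph R" and noR: "\<nexists>D. cycle_of D R" using R by (auto simp: tree_def)
  have sU: "simple_graph U" and uni: "\<exists>!C. cycle_of C U" using U by (auto simp: unicyclic_def)
  have unique: "D = map_graph Inr C" if D: "cycle_of D (disjoint_union R U)" for D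
    using cycle_of_disjoint_union[OF sR sU D] noR uni C by metis
  have "num_verts (map_graph Inr C :: ('a + 'b) sgraph) = num_verts C"
    by (simp add: num_verts_def card_image)
  then have "even (num_verts (map_graph Inr C :: ('a + 'b) sgraph))" using even by simp
  from graph_poly_unique_cycle[OF simple_graph_disjoint_union[OF sR sU] cycle_of_map_graph_Inr[OF C]
      unique this]
  show ?thesis by (simp add: delete_verts_disjoint_union)
qed

section \<open>Comparison of coefficients\<close>

text \<open>Let n be the common number of vertices. For i > n or n - i odd all coefficients vanish,
  as \<open>K\<close> has \<open>2 * l\<close> vertices fewer. For n - i = 2k the bound on
  \<open>i\<close> says 2k \<le> 2s + 1, which rounds down to k \<le> s.\<close>

lemma coeff_matching_poly_eq_if_num_matchings_eq:
  assumes T: "simple_graph T" and H: "simple_graph H" and K: "simple_graph K"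
    and n: "num_verts T = num_verts H" "num_verts K + 2 * l = num_verts H"
    and m: "\<And>k. k \<le> s \<Longrightarrow> int (num_matchings T (int k)) =
      int (num_matchings H (int k)) - 2 * (- 1) ^ l * int (num_matchings K (int k - int l))"
    and i: "num_verts H \<le> i + 2 * s + 1"
  shows "coeff (matching_poly T) i = coeff (matching_poly H - 2 * matching_poly K) i"
proof -
  let ?n = "num_verts H"
  note coeff = coeff_matching_poly[OF T, of i] coeff_matching_poly[OF H, of i]
    coeff_matching_poly[OF K, of i]
  have diff: "coeff (matching_poly H - 2 * matching_poly K) i =
      coeff (matching_poly H) i - 2 * coeff (matching_poly K) i"
    by (simp only: coeff_diff mult_2 coeff_add)
  show ?thesis
  proof (cases "i \<le> ?n \<and> even (?n - i)")
    case False
    then have "\<not> (i \<le> num_verts K \<and> even (num_verts K - i))"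
    proof (rule contrapos_nn)
      assume *: "i \<le> num_verts K \<and> even (num_verts K - i)"
      then have "?n - i = num_verts K - i + 2 * l" "i \<le> ?n" using n(2) by linarith+
      then show "i \<le> ?n \<and> even (?n - i)" using * by (metis dvd_add dvd_triv_left)
    qed
    then show ?thesis
      unfolding diff unfolding coeff n(1) using False by (simp only: if_False mult_zero_right diff_zero)
  next
    case True
    define k where "k = (?n - i) div 2"
    have k: "?n - i = 2 * k" unfolding k_def using True by (intro dvd_mult_div_cancel[symmetric]) blast
    have ks: "k \<le> s" using k i True by linarith
    \<comment> \<open>\<open>K\<close> has n - 2l vertices, so the same index counts its matchings
      with k - l edges, and (-1)^(k - l) is the product of (-1)^k and (-1)^l.\<close>
    have cK: "coeff (matching_poly K) i =
        (- 1) ^ k * (- 1) ^ l * of_nat (num_matchings K (int k - int l))"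
    proof (cases "l \<le> k")
      case True
      then have "num_verts K - i = 2 * (k - l)" "i \<le> num_verts K"
        using k n(2) \<open>i \<le> ?n \<and> even (?n - i)\<close> by linarith+
      moreover have "(- 1) ^ k * (- 1) ^ l = ((- 1) ^ (k - l) :: rat)"
      proof -
        have "(- 1) ^ k = ((- 1) ^ (k - l) * (- 1) ^ l :: rat)"
          unfolding power_add[symmetric] using True by simp
        moreover have "(- 1) ^ l * (- 1) ^ l = (1 :: rat)"
          unfolding power_mult_distrib[symmetric] by simp
        ultimately show ?thesis by (simp only: mult.assoc mult_1_right)
      qed
      moreover have "int (k - l) = int k - int l" using True by (rule of_nat_diff)
      ultimately show ?thesis unfolding coeff by simp
    next
      case False
      \<comment> \<open>For k < l both sides are 0: the index exceeds the degree, and the matchings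
        would have negative size.\<close>
      then have "num_verts K < i" using k n(2) True by linarith
      moreover have "num_matchings K (int k - int l) = 0"
        using False by (intro num_matchings_neg) linarith
      ultimately show ?thesis unfolding coeff by simp
    qed
    have cH: "coeff (matching_poly H) i = (- 1) ^ k * of_nat (num_matchings H (int k))"
      and cT: "coeff (matching_poly T) i = (- 1) ^ k * of_nat (num_matchings T (int k))"
      unfolding coeff n(1) if_P[OF True] k_def by (rule refl)+
    have "rat_of_int (int (num_matchings T (int k))) = rat_of_int (int (num_matchings H (int k)) -
        2 * (- 1) ^ l * int (num_matchings K (int k - int l)))"
      by (simp only: m[OF ks])
    then have mT: "(of_nat (num_matchings T (int k)) :: rat) = of_nat (num_matchings H (int k)) -
        2 * (- 1) ^ l * of_nat (num_matchings K (int k - int l))"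
      by simp
    show ?thesis unfolding diff cK cH cT mT by (simp add: algebra_simps)
  qed
qed

text \<open>A nonzero difference is a multiple of \<open>h\<close>, so its degree is at least that
  of \<open>h\<close>, where its leading coefficient is known to vanish.\<close>

lemma poly_eqI_of_common_divisor:
  fixes p q h :: "'b :: idom poly"
  assumes "h dvd p" "h dvd q" and coeff: "\<And>i. degree h \<le> i \<Longrightarrow> coeff p i = coeff q i"
  shows "p = q"
proof (rule ccontr)
  assume "p \<noteq> q"
  then have nz: "p - q \<noteq> 0" by simp
  have "h dvd p - q" using assms(1,2) by (rule dvd_diff)
  then have "degree h \<le> degree (p - q)" using nz by (rule dvd_imp_degree_le)
  then have "lead_coeff (p - q) = 0" using coeff by simp
  with nz show False unfolding leading_coeff_0_iff by (rule notE)
qed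

text \<open>The quotient is formed over the reals, while \<open>h\<close> is rational; the rational
  cofactor keeps its degree when mapped to the reals.\<close>

lemma degree_graph_poly_div:
  fixes h :: "rat poly"
  assumes "h dvd graph_poly G" "main_poly G = real_of_rat_poly h"
  shows "degree (graph_poly G div main_poly G) + degree h = num_verts G"
proof -
  interpret h: map_poly_inj_idom_hom "of_rat :: rat \<Rightarrow> real" ..
  obtain k where k: "graph_poly G = h * k" using assms(1) by (elim dvdE)
  then have nz: "h \<noteq> 0" "k \<noteq> 0" using graph_poly_nonzero[of G, where ?'b = rat] by auto
  have "(graph_poly G :: real poly) = map_poly of_rat (graph_poly G :: rat poly)"
    by (rule graph_poly_hom[OF of_rat_hom.comm_ring_hom_axioms, symmetric])
  also have "\<dots> = map_poly of_rat h * map_poly of_rat k" by (simp only: k h.hom_mult)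
  finally have "graph_poly G div main_poly G = (map_poly of_rat k :: real poly)"
    using nz by (simp add: assms(2) real_of_rat_poly_def)
  then have "degree (graph_poly G div main_poly G) = degree k" by simp
  moreover have "num_verts G = degree h + degree k"
    using degree_graph_poly[of G, where ?'b = rat] nz unfolding k by (simp add: degree_mult_eq)
  ultimately show ?thesis by simp
qed

theorem proposition4p9:
  fixes T :: "'a sgraph" and R :: "'b sgraph" and U :: "'c sgraph"
    and C F :: "'c sgraph" and H :: "('b + 'c) sgraph"
    and f g :: "rat poly" and \<Gamma>f \<Gamma>g :: "rat poly fract"
    and n d l :: nat
  assumes "tree T" and "num_verts T = n" and "main_factor_mult T = 2"
    and "main_poly T = real_of_rat_poly (f * g)" and "f \<noteq> g"
    and "lead_coeff f = 1" and "irreducible f" and "lead_coeff g = 1" and "irreducible g"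
    and "factor_coronals T f g \<Gamma>f \<Gamma>g"
    and "tree R" and "unicyclic U" and "bipartite U"
    and "(coronal R = \<Gamma>f \<and> coronal U = \<Gamma>g) \<or> (coronal R = \<Gamma>g \<and> coronal U = \<Gamma>f)"
    and "H = disjoint_union R U"
    and "cycle_of C U" and "num_verts C = 2 * l"
    and "F = delete_verts U (verts C)"
    and "d = degree (graph_poly T div main_poly T)"
  shows "(\<forall>s :: nat. s \<le> n div 2 \<longrightarrow>
            (\<forall>k :: int. 0 \<le> k \<and> k \<le> int s \<longrightarrow>
               int (num_matchings T k) =
                 int (num_matchings H k)
                 - 2 * (- 1) ^ l * int (num_matchings (disjoint_union R F) (k - int l))) \<longrightarrow>
            d \<le> 2 * s + 1 \<longrightarrow> generalized_cospectral T H) \<and>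
         (d \<le> 3 \<longrightarrow> generalized_cospectral T H) \<and>
         (6 \<le> num_verts C \<and> d \<le> 5 \<longrightarrow> generalized_cospectral T H)"
proof -
  have T: "simple_graph T" and acyclic: "\<nexists>D. cycle_of D T"
    using \<open>tree T\<close> by (auto simp: tree_def)
  have R: "simple_graph R" "verts R \<noteq> {}"
    using \<open>tree R\<close> by (auto simp: tree_def connected_graph_def)
  have U: "simple_graph U" "verts U \<noteq> {}"
    using \<open>unicyclic U\<close> by (auto simp: unicyclic_def connected_graph_def)
  note fin = simple_graphD(1)
  have H: "simple_graph H"
    unfolding assms(15) by (rule simple_graph_disjoint_union[OF R(1) U(1)])
  define K where "K = disjoint_union R F"
  have K: "simple_graph K"
    unfolding K_def assms(18)
    by (rule simple_graph_disjoint_union[OF R(1) simple_graph_delete_verts[OF U(1)]])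
  obtain A B where AB: "degree A < degree f" "degree B < degree g"
    "\<Gamma>f = to_fract A / to_fract f" "\<Gamma>g = to_fract B / to_fract g" "coronal T = \<Gamma>f + \<Gamma>g"
    using assms(10) unfolding factor_coronals_def by (elim exE conjE)
  \<comment> \<open>Connected graphs have vertices, so neither coronal is 0, and both
    \<open>f\<close> and \<open>g\<close> really occur in the denominator.\<close>
  have "\<Gamma>f \<noteq> 0" "\<Gamma>g \<noteq> 0"
    using assms(14) coronal_eq_0_iff[OF fin[OF R(1)]] coronal_eq_0_iff[OF fin[OF U(1)]] R(2) U(2)
    by auto
  then have nz: "A \<noteq> 0" "B \<noteq> 0" unfolding AB(3,4) by auto
  have coronal: "coronal H = coronal T"
    unfolding assms(15) coronal_disjoint_union[OF fin[OF R(1)] fin[OF U(1)]] AB(5)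
    using assms(14) by (auto simp: add.commute)
  note dvd = coronal_denominator_dvd[OF _ assms(7,9,6,8,5) AB(1,2) nz]
  have dvdT: "f * g dvd graph_poly T"
    by (rule dvd[OF fin[OF T]]) (simp only: AB(3-5))
  have dvdH: "f * g dvd graph_poly H"
    by (rule dvd[OF fin[OF H]]) (simp only: AB(3-5) coronal)
  note moments = coronal_eq_imp_degree_moments_eq[OF fin[OF H] fin[OF T] coronal]
  have d: "d + degree (f * g) = num_verts H"
    unfolding assms(19) moments(1) by (rule degree_graph_poly_div[OF dvdT assms(4)])
  have polyT: "graph_poly T = matching_poly T" by (rule graph_poly_acyclic[OF T acyclic])
  have polyH: "graph_poly H = matching_poly H - 2 * matching_poly K"
    unfolding assms(15,18) K_def
    by (rule graph_poly_disjoint_union_unicyclic[OF assms(11,12,16)]) (simp add: assms(17))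
  have CU: "verts C \<subseteq> verts U" and cyc: "cycle_graph C"
    using assms(16) by (auto simp: cycle_of_def subgraph_def)
  have fC: "finite (verts C)" by (rule finite_subset[OF CU fin[OF U(1)]])
  have nsum: "num_verts (disjoint_union R X) = num_verts R + num_verts X"
    if "finite (verts X)" for X :: "'c sgraph"
    unfolding num_verts_def verts_disjoint_union
    using fin[OF R(1)] that by (subst card_Un_disjoint) (auto simp: card_image)
  have "num_verts F + num_verts C = num_verts U"
    unfolding assms(18) num_verts_def delete_verts_def
    using card_Diff_subset[OF fC CU] card_mono[OF fin[OF U(1)] CU] by simp
  then have "num_verts K + num_verts C = num_verts H"
    unfolding K_def assms(15)
    by (subst (1 2) nsum) (simp_all add: fin[OF U(1)] assms(18) delete_verts_def)
  then have nK: "num_verts K + 2 * l = num_verts H" by (simp only: assms(17))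
  \<comment> \<open>All three claims are instances of this one: with the given s, with s = 1 and
    with s = 2.\<close>
  have main: "generalized_cospectral T H"
    if m: "\<And>k. k \<le> s \<Longrightarrow> int (num_matchings T (int k)) =
      int (num_matchings H (int k)) - 2 * (- 1) ^ l * int (num_matchings K (int k - int l))"
      and ds: "d \<le> 2 * s + 1" for s
  proof (rule generalized_cospectralI[OF T H _ coronal[symmetric]])
    show "graph_poly T = (graph_poly H :: rat poly)"
    proof (rule poly_eqI_of_common_divisor[OF dvdT dvdH])
      fix i assume "degree (f * g) \<le> i"
      then have i: "num_verts H \<le> i + 2 * s + 1" using d ds by linarith
      show "coeff (graph_poly T :: rat poly) i = coeff (graph_poly H) i"
        unfolding polyT polyH
        by (rule coeff_matching_poly_eq_if_num_matchings_eq[OF T H K moments(1)[symmetric] nK m i])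
    qed
  qed
  have m0: "num_matchings T 0 = num_matchings H 0"
    by (simp only: num_matchings_0[OF T] num_matchings_0[OF H])
  have e: "card (edges T) = card (edges H)"
    using moments(2) unfolding sum_vdeg[OF T] sum_vdeg[OF H] by simp
  then have m1: "num_matchings T 1 = num_matchings H 1" by (simp only: num_matchings_1)
  have m2: "num_matchings T 2 = num_matchings H 2"
    using num_matchings_2[OF T] num_matchings_2[OF H] moments(3) e by simp
  obtain vs where vs: "distinct vs" "3 \<le> length vs" "verts C = set vs"
    using cyc unfolding cycle_graph_def by (elim exE conjE)
  have "3 \<le> num_verts C"
    unfolding num_verts_def vs(3) distinct_card[OF vs(1)] by (rule vs(2))
  \<comment> \<open>The cycle has even length, so 3 \<le> 2l already gives l \<ge> 2.\<close>
  then have l2: "2 \<le> l" using assms(17) by linarith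
  have small: "num_matchings K (int k - int l) = 0" if "k < l" for k
    using that by (intro num_matchings_neg) linarith
  show ?thesis
  proof (intro conjI allI impI)
    fix s :: nat
    assume *: "\<forall>k :: int. 0 \<le> k \<and> k \<le> int s \<longrightarrow> int (num_matchings T k) =
      int (num_matchings H k) - 2 * (- 1) ^ l * int (num_matchings (disjoint_union R F) (k - int l))"
      and "d \<le> 2 * s + 1"
    then show "generalized_cospectral T H"
      by (intro main[of s]) (simp_all add: K_def)
  next
    assume "d \<le> 3"
    show "generalized_cospectral T H"
    \<comment> \<open>Here 2s + 1 = 3. For k \<le> 1 < l the correction vanishes, and the identities
      compare empty matchings and numbers of edges.\<close>
    proof (rule main[of 1])
      fix k :: nat assume "k \<le> 1"
      then consider "k = 0" | "k = 1" by linarith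
      then show "int (num_matchings T (int k)) = int (num_matchings H (int k)) -
          2 * (- 1) ^ l * int (num_matchings K (int k - int l))"
        by cases (use small[of k] l2 m0 m1 in simp_all)
    qed (use \<open>d \<le> 3\<close> in simp)
  next
    assume *: "6 \<le> num_verts C \<and> d \<le> 5"
    then have l3: "3 \<le> l" using assms(17) by linarith
    show "generalized_cospectral T H"
    \<comment> \<open>Here 2s + 1 = 5. Length at least six gives l \<ge> 3, so the correction still
      vanishes at k = 2, where the squared degrees settle the identity; a cycle of length four would
      contribute there.\<close>
    proof (rule main[of 2])
      fix k :: nat assume "k \<le> 2"
      then consider "k = 0" | "k = 1" | "k = 2" by linarith
      then show "int (num_matchings T (int k)) = int (num_matchings H (int k)) -
          2 * (- 1) ^ l * int (num_matchings K (int k - int l))"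
        by cases (use small[of k] l3 m0 m1 m2 in simp_all)
    qed (use * in simp)
  qed
qed

end
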